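(* Let $\alpha\in\mathbb{R}\setminus\mathbb{Q}$, let $Tx=x+\alpha$ on $\mathbb{T}=\mathbb{R}/\mathbb{Z}$, and let $f:\mathbb{T}\to\mathbb{R}$ be a continuous positive function. For $s\in\mathbb{R}^*$ we have $s\in I_{top}(T^f)\setminus\{1\}$ if and only if $s\ne 1$ and there exist a matrix $A=[a_{ij}]\in GL_2(\mathbb{Z})$, $\delta\in\mathbb{R}$ and a continuous function $g:\mathbb{R}\to\mathbb{R}$ such that, with $\sigma=\det A$, $$a_{12}+a_{22}\alpha=(a_{11}+a_{21}\alpha)\alpha,$$ $$a_{11}+a_{21}\alpha=\sigma s=\sigma(a_{22}-a_{21}\alpha)^{-1},$$ $$s\widetilde f^{(a_{21}n+a_{22}m)}(\sigma sx+\delta)-\widetilde f^{(m)}(x)=g(x)-g(x+n+m\alpha)\quad\text{for all }m,n\in\mathbb{Z},\ x\in\mathbb{R}.$$ Moreover, $-1\in I_{top}(T^f)$ if and only if there exist a continuous map $g:\mathbb{T}\to\mathbb{R}$ and $\delta\in\mathbb{T}$ such that $$f(\delta-x)-f(x)=g(x)-g(x+\alpha)\quad\text{for all }x\in\mathbb{T}.$$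
   Context: $\widetilde f:\mathbb{R}\to\mathbb{R}$ is the $1$-periodic lift of $f$, and $\widetilde f^{(k)}(x)=\sum_{j=0}^{k-1}\widetilde f(x+j\alpha)$ for $k>0$, $\widetilde f^{(0)}=0$, $\widetilde f^{(k)}(x)=-\sum_{j=k}^{-1}\widetilde f(x+j\alpha)$ for $k<0$. Topological special flow: $X^f$ is the quotient of $\mathbb{T}\times\mathbb{R}$ by the orbit relation of the homeomorphism $T_{-f}(x,r)=(Tx,r-f(x))$; the flow $\sigma_t(x,r)=(x,r+t)$ commutes with $T_{-f}$ and hence induces a continuous flow $T^f=(T^f_t)_{t\in\mathbb{R}}$ on the compact space $X^f$. For a continuous flow $\mathcal{T}=(T_t)_{t\in\mathbb{R}}$ on a compact metric space, $I_{top}(\mathcal{T})$ is the group of $s\in\mathbb{R}^*=\mathbb{R}\setminus\{0\}$ such that $\mathcal{T}$ and $\mathcal{T}\circ s=(T_{st})_{t\in\mathbb{R}}$ are topologically conjugate. *)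

theory Defs
  imports "HOL-Analysis.Analysis"
begin

quotient_type circle = real / "\<lambda>x y::real. x - y \<in> \<int>"
  morphisms rep_circle to_circle
proof (rule equivpI)
  show "reflp (\<lambda>x y::real. x - y \<in> \<int>)" by (simp add: reflp_def)
  show "symp (\<lambda>x y::real. x - y \<in> \<int>)"
    by (rule sympI) (metis Ints_minus minus_diff_eq)
  show "transp (\<lambda>x y::real. x - y \<in> \<int>)"
  proof (rule transpI)
    fix x y z :: real assume "x - y \<in> \<int>" "y - z \<in> \<int>"
    then have "(x - y) + (y - z) \<in> \<int>" by (rule Ints_add)
    then show "x - z \<in> \<int>" by simp
  qed
qed

instantiation circle :: ab_group_add
begin

lift_definition zero_circle :: circle is "0 :: real" .

lift_definition plus_circle :: "circle \<Rightarrow> circle \<Rightarrow> circle" is "(+) :: real \<Rightarrow> _"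
  by (metis Ints_add add_diff_add)

lift_definition uminus_circle :: "circle \<Rightarrow> circle" is "uminus :: real \<Rightarrow> _"
  by (metis Ints_minus minus_diff_minus)

definition minus_circle :: "circle \<Rightarrow> circle \<Rightarrow> circle" where
  "minus_circle x y = x + (- y)"

instance
proof
  fix a b c :: circle
  show "a + b + c = a + (b + c)" by transfer (simp add: add.assoc)
  show "a + b = b + a" by transfer (simp add: add.commute)
  show "0 + a = a" by transfer simp
  show "- a + a = 0" by transfer simp
  show "a - b = a + - b" by (rule minus_circle_def)
qed

end

lemma to_circle_eq_iff: "to_circle x = to_circle y \<longleftrightarrow> x - y \<in> \<int>"
  by (simp add: circle.abs_eq_iff)

lemma to_circle_add: "to_circle (x + y) = to_circle x + to_circle y"
  by (simp add: plus_circle.abs_eq)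

instantiation circle :: topological_space
begin

definition open_circle :: "circle set \<Rightarrow> bool" where
  "open_circle U \<longleftrightarrow> open (to_circle -` U)"

instance
  by standard (auto simp: open_circle_def vimage_Union)

end

definition rotation :: "real \<Rightarrow> circle \<Rightarrow> circle" where
  "rotation \<alpha> x = x + to_circle \<alpha>"

definition periodic_lift :: "(circle \<Rightarrow> real) \<Rightarrow> real \<Rightarrow> real" where
  "periodic_lift f x = f (to_circle x)"

definition cocycle :: "real \<Rightarrow> (real \<Rightarrow> real) \<Rightarrow> int \<Rightarrow> real \<Rightarrow> real" where
  "cocycle \<alpha> F k x =
     (if k \<ge> 0 then (\<Sum>j = 0..<k. F (x + of_int j * \<alpha>))
      else - (\<Sum>j = k..<0. F (x + of_int j * \<alpha>)))"

definition quotient_topology :: "'a topology \<Rightarrow> ('a \<times> 'a) set \<Rightarrow> 'a set topology" where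
  "quotient_topology X R =
     topology (\<lambda>U. U \<subseteq> topspace X // R \<and> openin X {x \<in> topspace X. R `` {x} \<in> U})"

lemma openin_quotient_topology:
  "openin (quotient_topology X R) U \<longleftrightarrow>
     U \<subseteq> topspace X // R \<and> openin X {x \<in> topspace X. R `` {x} \<in> U}"
proof -
  have "istopology (\<lambda>U. U \<subseteq> topspace X // R \<and> openin X {x \<in> topspace X. R `` {x} \<in> U})"
    (is "istopology ?P")
  proof -
    have "?P (S \<inter> T)" if "?P S" "?P T" for S T
    proof -
      have "{x \<in> topspace X. R `` {x} \<in> S \<inter> T} =
            {x \<in> topspace X. R `` {x} \<in> S} \<inter> {x \<in> topspace X. R `` {x} \<in> T}" by auto
      then show ?thesis using that by auto
    qed
    moreover have "?P (\<Union>\<K>)" if "\<forall>K\<in>\<K>. ?P K" for \<K>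
    proof -
      have "{x \<in> topspace X. R `` {x} \<in> \<Union>\<K>} =
            (\<Union>K\<in>\<K>. {x \<in> topspace X. R `` {x} \<in> K})" by auto
      moreover have "openin X (\<Union>K\<in>\<K>. {x \<in> topspace X. R `` {x} \<in> K})"
        using that by (intro openin_Union) auto
      ultimately show ?thesis using that by auto
    qed
    ultimately show ?thesis unfolding istopology_def by blast
  qed
  then show ?thesis by (simp add: quotient_topology_def)
qed

lemma topspace_quotient_topology [simp]:
  "topspace (quotient_topology X R) = topspace X // R"
proof -
  have "{x \<in> topspace X. R `` {x} \<in> topspace X // R} = topspace X"
    by (auto intro: quotientI)
  then have "openin (quotient_topology X R) (topspace X // R)"
    by (simp add: openin_quotient_topology)
  then show ?thesis
    by (meson openin_quotient_topology openin_subset openin_topspace subset_antisym)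
qed

lemma quotient_map_quotient_topology:
  "quotient_map X (quotient_topology X R) (\<lambda>x. R `` {x})"
  by (auto simp: quotient_map_def openin_quotient_topology quotient_def)

definition int_iterate :: "('a \<Rightarrow> 'a) \<Rightarrow> int \<Rightarrow> 'a \<Rightarrow> 'a" where
  "int_iterate F k = (if k \<ge> 0 then F ^^ nat k else inv F ^^ nat (- k))"

definition orbit_relation :: "('a \<Rightarrow> 'a) \<Rightarrow> ('a \<times> 'a) set" where
  "orbit_relation F = {(p, q). \<exists>k. q = int_iterate F k p}"

lemma orbit_relation_iff:
  assumes "bij F"
  shows "(p, q) \<in> orbit_relation F \<longleftrightarrow> (\<exists>n. q = (F ^^ n) p \<or> p = (F ^^ n) q)"
proof -
  have inv: "q = (inv F ^^ n) p \<longleftrightarrow> p = (F ^^ n) q" for n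
    using assms
    by (metis bij_fn bij_inv_eq_iff inv_fn)
  show ?thesis
  proof
    assume "(p, q) \<in> orbit_relation F"
    then show "\<exists>n. q = (F ^^ n) p \<or> p = (F ^^ n) q"
      by (auto simp: orbit_relation_def int_iterate_def inv split: if_splits)
  next
    assume "\<exists>n. q = (F ^^ n) p \<or> p = (F ^^ n) q"
    then obtain n where "q = (F ^^ n) p \<or> q = (inv F ^^ n) p"
      using inv by blast
    then have "q = int_iterate F (int n) p \<or> q = int_iterate F (- int n) p"
      by (auto simp: int_iterate_def)
    then show "(p, q) \<in> orbit_relation F"
      by (auto simp: orbit_relation_def)
  qed
qed

lemma equiv_orbit_relation:
  assumes "bij F"
  shows "equiv UNIV (orbit_relation F)"
proof (rule equivI)
  note iff = orbit_relation_iff[OF assms]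
  have inj: "inj (F ^^ n)" for n using assms by (simp add: bij_fn bij_is_inj)
  show "orbit_relation F \<subseteq> UNIV \<times> UNIV" by simp
  show "refl (orbit_relation F)"
    by (rule refl_onI) (auto simp: iff intro: exI[of _ 0])
  show "sym (orbit_relation F)"
    by (rule symI) (auto simp: iff)
  show "trans (orbit_relation F)"
  proof (rule transI)
    fix p q r assume "(p, q) \<in> orbit_relation F" "(q, r) \<in> orbit_relation F"
    then obtain m n where m: "q = (F ^^ m) p \<or> p = (F ^^ m) q"
      and n: "r = (F ^^ n) q \<or> q = (F ^^ n) r" by (auto simp: iff)
    have cmp: "\<exists>k. v = (F ^^ k) u \<or> u = (F ^^ k) v"
      if "(F ^^ a) u = (F ^^ b) v" for a b u v
    proof (cases "a \<le> b")
      case True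
      then have "(F ^^ a) u = (F ^^ a) ((F ^^ (b - a)) v)"
        using that by (metis add_diff_inverse_nat comp_apply funpow_add linorder_not_less)
      then show ?thesis using inj by (meson injD)
    next
      case False
      then have "(F ^^ b) v = (F ^^ b) ((F ^^ (a - b)) u)"
        using that by (metis add_diff_inverse_nat comp_apply funpow_add less_imp_le linorder_not_less)
      then show ?thesis using inj by (meson injD)
    qed
    consider "q = (F ^^ m) p" "r = (F ^^ n) q" | "q = (F ^^ m) p" "q = (F ^^ n) r"
      | "p = (F ^^ m) q" "r = (F ^^ n) q" | "p = (F ^^ m) q" "q = (F ^^ n) r"
      using m n by blast
    then show "(p, r) \<in> orbit_relation F"
    proof cases
      case 1
      then have "r = (F ^^ (n + m)) p" by (simp add: funpow_add)
      then show ?thesis unfolding iff by blast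
    next
      case 2
      then have "(F ^^ m) p = (F ^^ n) r" by simp
      then show ?thesis unfolding iff by (rule cmp)
    next
      case 3
      then have "(F ^^ n) p = (F ^^ m) r" 
        by (metis add.commute comp_apply funpow_add)
      then show ?thesis unfolding iff by (rule cmp)
    next
      case 4
      then have "p = (F ^^ (m + n)) r" by (simp add: funpow_add)
      then show ?thesis unfolding iff by blast
    qed
  qed
qed

definition skew :: "real \<Rightarrow> (circle \<Rightarrow> real) \<Rightarrow> circle \<times> real \<Rightarrow> circle \<times> real" where
  "skew \<alpha> f = (\<lambda>(x, r). (rotation \<alpha> x, r - f x))"

definition vertical_flow :: "real \<Rightarrow> circle \<times> real \<Rightarrow> circle \<times> real" where
  "vertical_flow t = (\<lambda>(x, r). (x, r + t))"

lemma bij_skew: "bij (skew \<alpha> f)"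
  by (rule bij_betw_byWitness[where
        f' = "\<lambda>(x, r). (x - to_circle \<alpha>, r + f (x - to_circle \<alpha>))"])
     (auto simp: skew_def rotation_def)

definition special_space :: "real \<Rightarrow> (circle \<Rightarrow> real) \<Rightarrow> (circle \<times> real) set topology" where
  "special_space \<alpha> f = quotient_topology euclidean (orbit_relation (skew \<alpha> f))"

text \<open>
  Points of the special space are orbits of \<^term>\<open>skew \<alpha> f\<close>. Since the vertical flow commutes with
  \<^term>\<open>skew \<alpha> f\<close>, it maps orbits to orbits, so the induced flow is the direct image; see
  \<open>special_flow_class\<close> below.
\<close>

definition special_flow :: "real \<Rightarrow> (circle \<times> real) set \<Rightarrow> (circle \<times> real) set" where
  "special_flow t C = vertical_flow t ` C"

lemma vertical_flow_skew_commute: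
  "vertical_flow t (skew \<alpha> f p) = skew \<alpha> f (vertical_flow t p)"
  by (cases p) (simp add: skew_def vertical_flow_def)

lemma special_flow_class:
  "special_flow t (orbit_relation (skew \<alpha> f) `` {p}) =
     orbit_relation (skew \<alpha> f) `` {vertical_flow t p}"
proof -
  have it: "vertical_flow t ((skew \<alpha> f ^^ n) p) = (skew \<alpha> f ^^ n) (vertical_flow t p)" for n t p
    by (induction n) (simp_all add: vertical_flow_skew_commute)
  have inv: "vertical_flow (- t) (vertical_flow t p) = p"
    "vertical_flow t (vertical_flow (- t) p) = p" for t p
    by (simp_all add: vertical_flow_def split: prod.splits)
  have fwd: "(vertical_flow t p, vertical_flow t q) \<in> orbit_relation (skew \<alpha> f)"
    if "(p, q) \<in> orbit_relation (skew \<alpha> f)" for t p q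
    using that unfolding orbit_relation_iff[OF bij_skew] by (metis it)
  show ?thesis
  proof
    show "special_flow t (orbit_relation (skew \<alpha> f) `` {p})
            \<subseteq> orbit_relation (skew \<alpha> f) `` {vertical_flow t p}"
      using fwd by (auto simp: special_flow_def)
    show "orbit_relation (skew \<alpha> f) `` {vertical_flow t p}
            \<subseteq> special_flow t (orbit_relation (skew \<alpha> f) `` {p})"
    proof
      fix q assume "q \<in> orbit_relation (skew \<alpha> f) `` {vertical_flow t p}"
      then have "(p, vertical_flow (- t) q) \<in> orbit_relation (skew \<alpha> f)"
        using fwd[of "vertical_flow t p" q "- t"] by (simp add: inv)
      then show "q \<in> special_flow t (orbit_relation (skew \<alpha> f) `` {p})"
        unfolding special_flow_def by (metis Image_singleton_iff imageI inv(2))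
    qed
  qed
qed

definition topologically_conjugate ::
  "'a topology \<Rightarrow> (real \<Rightarrow> 'a \<Rightarrow> 'a) \<Rightarrow> 'b topology \<Rightarrow> (real \<Rightarrow> 'b \<Rightarrow> 'b) \<Rightarrow> bool" where
  "topologically_conjugate X \<phi> Y \<psi> \<longleftrightarrow>
     (\<exists>h. homeomorphic_map X Y h \<and> (\<forall>t. \<forall>x\<in>topspace X. h (\<phi> t x) = \<psi> t (h x)))"

definition I_top :: "'a topology \<Rightarrow> (real \<Rightarrow> 'a \<Rightarrow> 'a) \<Rightarrow> real set" where
  "I_top X \<phi> = {s. s \<noteq> 0 \<and> topologically_conjugate X \<phi> X (\<lambda>t. \<phi> (s * t))}"

end

theory Submission
  imports Defs
begin

text \<open>
  The space \<open>X\<close> is the quotient of the plane by the free, properly discontinuous action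
  \<open>(n, m) \<cdot> (x, r) = (x + n + m\<alpha>, r - F\<^sup>(\<^sup>m\<^sup>)(x))\<close> of \<open>\<int>\<^sup>2\<close>. A conjugacy between the flow and its
  rescaling lifts to a map \<open>(x, r) \<mapsto> (\<phi> x, s r + \<rho> x)\<close> of the plane that is equivariant up to an
  automorphism \<open>A\<close> of \<open>\<int>\<^sup>2\<close>. The density of \<open>\<int> + \<alpha>\<int>\<close> forces \<open>\<phi>\<close> to be affine with slope
  \<open>a\<^sub>1\<^sub>1 + a\<^sub>2\<^sub>1\<alpha>\<close>, equivariance in the second coordinate is the cohomological equation, and averaging
  that equation identifies the time change. Conversely, a solution of the equation defines an
  equivariant homeomorphism of the plane, which descends to \<open>X\<close>. In the statement the matrix and the
  transfer function belong to the inverse of the conjugacy, whence the factor \<open>s\<close> in front of the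
  cocycle.
\<close>

section \<open>Quasi-periodic functions and cocycles over an irrational rotation\<close>

lemma add_of_int_mult_irrational_eq_iff:
  fixes \<alpha> :: real
  assumes "\<alpha> \<notin> \<rat>"
  shows "of_int a + of_int b * \<alpha> = of_int c + of_int d * \<alpha> \<longleftrightarrow> a = c \<and> b = d"
proof
  assume eq: "of_int a + of_int b * \<alpha> = of_int c + of_int d * \<alpha>"
  have "b = d"
  proof (rule ccontr)
    assume "b \<noteq> d"
    then have "\<alpha> = of_int (c - a) / of_int (b - d)"
      using eq by (simp add: field_simps)
    then show False
      using assms by (metis Rats_divide Rats_of_int)
  qed
  with eq show "a = c \<and> b = d" by simp
qed simp

text \<open>The range is connected, and a connected set of reals with two points is
  uncountable.\<close>

lemma continuous_countable_range_constant:
  fixes u :: "real \<Rightarrow> real"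
  assumes "continuous_on UNIV u" "countable (range u)"
  shows "u x = u y"
proof -
  have "connected (range u)"
    using assms(1) connected_UNIV connected_continuous_image by blast
  then show ?thesis
    using connected_uncountable[of "range u" "u x" "u y"] assms(2) by blast
qed

text \<open>This turns a choice of integers made separately at each point into one choice for the
  whole line. It serves for the displacement of a lift and for the slope of a composite of
  lifts.\<close>

lemma continuous_int_translate_image_constant:
  fixes u :: "real \<Rightarrow> real"
  assumes "continuous_on UNIV u" "\<And>x. \<exists>n m :: int. u x = of_int n + of_int m * \<alpha>"
  shows "u x = u y"
proof (rule continuous_countable_range_constant[OF assms(1)])
  have "range u \<subseteq> (\<Union>n::int. \<Union>m::int. {of_int n + of_int m * \<alpha>})"
    using assms(2) by (simp add: image_subset_iff)
  then show "countable (range u)"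
    by (rule countable_subset) auto
qed

lemma periodic_of_int:
  fixes u :: "real \<Rightarrow> 'a"
  assumes "\<And>x. u (x + 1) = u x"
  shows "u (x + of_int n) = u x"
proof (induction n rule: int_induct[where k = 0])
  case (step1 i)
  then show ?case using assms[of "x + of_int i"] by (simp add: add.assoc)
next
  case (step2 i)
  then show ?case using assms[of "x + of_int (i - 1)"] by (simp add: algebra_simps)
qed simp

lemma periodic_image:
  fixes u :: "real \<Rightarrow> 'a"
  assumes "\<And>x. u (x + 1) = u x"
  shows "range u = u ` {0..1}"
proof -
  have "u x = u (frac x)" for x
    using periodic_of_int[of u "frac x" "\<lfloor>x\<rfloor>", OF assms] by (simp add: frac_def)
  moreover have "frac x \<in> {0..1}" for x :: real
    using frac_ge_0 frac_lt_1 less_imp_le by auto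
  ultimately show ?thesis by (metis (no_types, lifting) image_eqI image_subsetI subset_antisym subset_UNIV image_mono)
qed

lemma periodic_compact_range:
  fixes u :: "real \<Rightarrow> real"
  assumes "continuous_on UNIV u" "\<And>x. u (x + 1) = u x"
  shows "compact (range u)"
  unfolding periodic_image[of u, OF assms(2)]
  by (intro compact_continuous_image compact_Icc continuous_on_subset[OF assms(1)]) simp

lemma periodic_bounded:
  fixes u :: "real \<Rightarrow> real"
  assumes "continuous_on UNIV u" "\<And>x. u (x + 1) = u x"
  obtains M where "M > 0" "\<And>x. \<bar>u x\<bar> \<le> M"
  using compact_imp_bounded[OF periodic_compact_range[OF assms]]
  unfolding bounded_pos by auto

text \<open>The closed set where \<open>u\<close> equals \<open>u 0\<close> contains the fractional
  parts of all \<open>n * \<alpha>\<close>. By Kronecker these are dense in the unit interval, and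
  periodicity carries the result to the line.\<close>

lemma invariant_under_dense_group_constant:
  fixes u :: "real \<Rightarrow> real"
  assumes "\<alpha> \<notin> \<rat>" and cont: "continuous_on UNIV u"
    and per: "\<And>x. u (x + 1) = u x" and inv: "\<And>x. u (x + \<alpha>) = u x"
  shows "u x = u 0"
proof -
  let ?S = "{x. u x = u 0}"
  have "closed ?S"
    using cont by (intro closed_Collect_eq) auto
  moreover have "u (real n * \<alpha>) = u 0" for n
  proof (induction n)
    case (Suc n)
    then show ?case using inv[of "real n * \<alpha>"] by (simp add: algebra_simps)
  qed simp
  then have "frac (real n * \<alpha>) \<in> ?S" for n
    using periodic_of_int[of u "frac (real n * \<alpha>)" "\<lfloor>real n * \<alpha>\<rfloor>", OF per]
    by (simp add: frac_def)
  ultimately have "closure (range (\<lambda>n. frac (real n * \<alpha>))) \<subseteq> ?S"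
    by (intro closure_minimal) auto
  then have "u ` {0..1} \<subseteq> {u 0}"
    using Kronecker_approx_1[OF assms(1)] by auto
  then show ?thesis
    using periodic_image[of u, OF per] by blast
qed

text \<open>Subtracting \<open>c * x\<close> leaves a bounded periodic \<open>u\<close> that gains a
  constant \<open>k\<close> under translation by \<alpha>. Along the multiples of \<alpha> it grows
  linearly unless \<open>k = 0\<close>; then \<open>u\<close> is invariant under a dense group,
  hence constant.\<close>

lemma quasi_periodic_affine:
  fixes \<phi> :: "real \<Rightarrow> real"
  assumes irr: "\<alpha> \<notin> \<rat>" and cont: "continuous_on UNIV \<phi>"
    and one: "\<And>x. \<phi> (x + 1) = \<phi> x + c" and alpha: "\<And>x. \<phi> (x + \<alpha>) = \<phi> x + d"
  shows "\<phi> x = c * x + \<phi> 0" and "d = c * \<alpha>"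
proof -
  define u where "u x = \<phi> x - c * x" for x
  define k where "k = d - c * \<alpha>"
  have contu: "continuous_on UNIV u"
    unfolding u_def by (intro continuous_intros cont)
  have per: "u (x + 1) = u x" for x
    using one[of x] by (simp add: u_def algebra_simps)
  have step: "u (x + \<alpha>) = u x + k" for x
    using alpha[of x] by (simp add: u_def k_def algebra_simps)
  have iter: "u (real n * \<alpha>) = u 0 + real n * k" for n
  proof (induction n)
    case (Suc n)
    then show ?case using step[of "real n * \<alpha>"] by (simp add: algebra_simps)
  qed simp
  obtain M where M: "\<And>x. \<bar>u x\<bar> \<le> M"
    using periodic_bounded[OF contu per] by blast
  have "k = 0"
  proof (rule ccontr)
    assume "k \<noteq> 0"
    then obtain n where n: "real n * \<bar>k\<bar> > 2 * M"
      using reals_Archimedean3[of "\<bar>k\<bar>"] by auto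
    have "\<bar>real n * k\<bar> \<le> 2 * M"
      using M[of "real n * \<alpha>"] M[of 0] iter[of n] by linarith
    with n show False by (simp add: abs_mult)
  qed
  then show "d = c * \<alpha>" by (simp add: k_def)
  show "\<phi> x = c * x + \<phi> 0"
    using invariant_under_dense_group_constant[OF irr contu per, of x] step \<open>k = 0\<close>
    by (simp add: u_def)
qed

section \<open>Identities, bounds and derivatives of Birkhoff cocycles\<close>

lemma cocycle_0 [simp]: "cocycle \<alpha> F 0 x = 0"
  by (simp add: cocycle_def)

text \<open>The sign convention for negative indices makes this recursion hold across zero as well,
  so that the cocycle identities follow by induction over the integers in both directions.\<close>

lemma cocycle_Suc: "cocycle \<alpha> F (k + 1) x = cocycle \<alpha> F k x + F (x + of_int k * \<alpha>)"
proof -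
  consider "k \<ge> 0" | "k = -1" | "k < -1" by linarith
  then show ?thesis
  proof cases
    case 1
    then have "{0..<k + 1} = insert k {0..<k}" by auto
    with 1 show ?thesis by (simp add: cocycle_def)
  next
    case 2
    moreover have "{- 1..<0} = {- 1::int}" by auto
    ultimately show ?thesis by (simp add: cocycle_def)
  next
    case 3
    then have "{k..<0} = insert k {k + 1..<0}" by auto
    with 3 show ?thesis by (simp add: cocycle_def)
  qed
qed

lemma cocycle_1 [simp]: "cocycle \<alpha> F 1 x = F x"
  using cocycle_Suc[of \<alpha> F 0 x] by simp

lemma cocycle_add: "cocycle \<alpha> F (j + k) x = cocycle \<alpha> F j x + cocycle \<alpha> F k (x + of_int j * \<alpha>)"
proof (induction k rule: int_induct[where k = 0])
  case (step1 i)
  then show ?case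
    using cocycle_Suc[of \<alpha> F "j + i" x] cocycle_Suc[of \<alpha> F i "x + of_int j * \<alpha>"]
    by (simp add: algebra_simps)
next
  case (step2 i)
  then show ?case
    using cocycle_Suc[of \<alpha> F "j + (i - 1)" x] cocycle_Suc[of \<alpha> F "i - 1" "x + of_int j * \<alpha>"]
    by (simp add: algebra_simps)
qed simp

lemma cocycle_uminus: "cocycle \<alpha> F (- k) x = - cocycle \<alpha> F k (x - of_int k * \<alpha>)"
  using cocycle_add[of \<alpha> F k "- k" "x - of_int k * \<alpha>"] by simp

lemma continuous_on_cocycle:
  assumes "continuous_on UNIV F"
  shows "continuous_on S (cocycle \<alpha> F k)"
proof -
  have "continuous_on UNIV (\<lambda>x. F (x + of_int j * \<alpha>))" for j :: int
    by (rule continuous_on_compose2[OF assms]) (auto intro!: continuous_intros)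
  then have "continuous_on UNIV (cocycle \<alpha> F k)"
    unfolding cocycle_def by (cases "k \<ge> 0") (auto intro!: continuous_intros)
  then show ?thesis by (rule continuous_on_subset) simp
qed

lemma cocycle_periodic:
  assumes "\<And>x. F (x + 1) = F x"
  shows "cocycle \<alpha> F k (x + of_int n) = cocycle \<alpha> F k x"
proof -
  have "F (x + of_int n + of_int j * \<alpha>) = F (x + of_int j * \<alpha>)" for j :: int
    using periodic_of_int[of F "x + of_int j * \<alpha>" n, OF assms] by (simp add: algebra_simps)
  then show ?thesis by (simp add: cocycle_def)
qed

text \<open>For a roof bounded away from zero this gives a uniform vertical displacement of every
  deck transformation with nonzero second index.\<close>

lemma cocycle_lower_bound:
  assumes "\<And>x. F x \<ge> c" "c \<ge> 0"
  shows "\<bar>cocycle \<alpha> F k x\<bar> \<ge> \<bar>of_int k\<bar> * c"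
proof -
  have "(\<Sum>j\<in>A. F (x + of_int j * \<alpha>)) \<ge> real (card A) * c" for A :: "int set"
    using sum_bounded_below[of A c "\<lambda>j. F (x + of_int j * \<alpha>)"] assms(1) by simp
  from this[of "{0..<k}"] this[of "{k..<0}"] show ?thesis
    using assms(2) by (auto simp: cocycle_def)
qed

lemma cocycle_upper_bound:
  assumes "\<And>x. \<bar>F x\<bar> \<le> M"
  shows "\<bar>cocycle \<alpha> F k x\<bar> \<le> \<bar>of_int k\<bar> * M"
proof -
  have "\<bar>\<Sum>j\<in>A. F (x + of_int j * \<alpha>)\<bar> \<le> real (card A) * M" for A :: "int set"
    using order_trans[OF sum_abs sum_bounded_above[of A "\<lambda>j. \<bar>F (x + of_int j * \<alpha>)\<bar>" M]] assms
    by simp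
  from this[of "{0..<k}"] this[of "{k..<0}"] show ?thesis
    by (auto simp: cocycle_def)
qed

text \<open>Since cocycles of primitives are primitives of cocycles, averages over an interval can
  be handled by the mean value theorem instead of integrals.\<close>

lemma has_field_derivative_cocycle:
  assumes "\<And>x. (P has_field_derivative F x) (at x)"
  shows "(cocycle \<alpha> P k has_field_derivative cocycle \<alpha> F k x) (at x)"
proof -
  have "((\<lambda>x. P (x + of_int j * \<alpha>)) has_field_derivative F (x + of_int j * \<alpha>)) (at x)" for j :: int
    using assms[of "x + of_int j * \<alpha>"] by (rule DERIV_shift[THEN iffD1])
  then show ?thesis
    unfolding cocycle_def by (cases "k \<ge> 0") (auto intro!: derivative_eq_intros)
qed

section \<open>Mean values and the identification of the time change\<close>

lemma continuous_imp_antiderivative: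
  fixes F :: "real \<Rightarrow> real"
  assumes "continuous_on UNIV F"
  obtains P where "\<And>x. (P has_field_derivative F x) (at x)"
proof -
  have "isCont F x" for x
    using assms by (simp add: continuous_on_eq_continuous_at)
  then have "\<exists>P. \<forall>x. (P has_vector_derivative F x) (at x)"
    using einterval_antiderivative[of "-\<infinity>" "\<infinity>" F] by simp
  then show ?thesis
    unfolding has_real_derivative_iff_has_vector_derivative[symmetric] using that by blast
qed

text \<open>Here \<open>I\<close> is the mean of \<open>F\<close> over a period. Removing it makes
  the primitive periodic, hence bounded.\<close>

lemma periodic_mean_antiderivative:
  fixes F :: "real \<Rightarrow> real"
  assumes cont: "continuous_on UNIV F" and per: "\<And>x. F (x + 1) = F x" and pos: "\<And>x. F x > 0"
  obtains P I M where "I > 0" "\<And>x. (P has_field_derivative F x - I) (at x)" "M > 0" "\<And>x. \<bar>P x\<bar> \<le> M"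
proof -
  obtain Q where Q: "\<And>x. (Q has_field_derivative F x) (at x)"
    using continuous_imp_antiderivative[OF cont] by blast
  define I where "I = Q 1 - Q 0"
  have "I > 0"
    unfolding I_def using DERIV_pos_imp_increasing[of 0 1 Q] Q pos by fastforce
  have "((\<lambda>x. Q (x + 1) - Q x) has_field_derivative 0) (at x)" for x
    using DERIV_diff[OF DERIV_shift[THEN iffD1, OF Q[of "x + 1"]] Q[of x]] per[of x] by simp
  then have QI: "Q (x + 1) - Q x = I" for x
    unfolding I_def using DERIV_isconst_all[of "\<lambda>x. Q (x + 1) - Q x" x 0] by simp
  define P where "P x = Q x - I * x" for x
  have P: "(P has_field_derivative F x - I) (at x)" for x
    unfolding P_def using Q[of x] by (auto intro!: derivative_eq_intros)
  have contP: "continuous_on UNIV P"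
    using P by (meson DERIV_isCont continuous_at_imp_continuous_on)
  have "P (x + 1) = P x" for x
    using QI[of x] by (simp add: P_def algebra_simps)
  then obtain M where "M > 0" "\<And>x. \<bar>P x\<bar> \<le> M"
    using periodic_bounded[OF contP] by blast
  with \<open>I > 0\<close> P show ?thesis using that by blast
qed

text \<open>
  An equation of this kind holds between the heights of two special flows over the rotation that
  are intertwined up to the time change \<open>s\<close>. Averaging it over \<open>[0, L]\<close> with \<open>n + m\<alpha> \<in> [0, 1)\<close> kept
  bounded and \<open>m \<rightarrow> \<infinity>\<close> replaces both cocycles by multiples of the mean of \<open>F\<close>, up to a relative
  error \<open>O(1 / L)\<close>.
\<close>

lemma time_change_eq_of_cohomologous:
  fixes F \<rho> :: "real \<Rightarrow> real" and p r :: int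
  assumes cont: "continuous_on UNIV F" and per: "\<And>x. F (x + 1) = F x" and pos: "\<And>x. F x > 0"
    and "c \<noteq> 0" and cont\<rho>: "continuous_on UNIV \<rho>"
    and coh: "\<And>m n x. cocycle \<alpha> F (p * n + r * m) (c * x + \<delta>) - s * cocycle \<alpha> F m x
                = \<rho> x - \<rho> (x + of_int n + of_int m * \<alpha>)"
  shows "of_int r - of_int p * \<alpha> = s"
proof -
  obtain P I M where "I > 0" and P: "\<And>x. (P has_field_derivative F x - I) (at x)"
    and "M > 0" and M: "\<And>x. \<bar>P x\<bar> \<le> M"
    using periodic_mean_antiderivative[of F, OF cont per pos] by metis
  have cocI: "cocycle \<alpha> (\<lambda>x. F x - I) k x = cocycle \<alpha> F k x - of_int k * I" for k x
    by (simp add: cocycle_def sum_subtractf algebra_simps)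
  note dP = has_field_derivative_cocycle[of P "\<lambda>x. F x - I" \<alpha>, OF P, unfolded cocI]
  define \<beta> where "\<beta> = of_int r - of_int p * \<alpha>"
  define d where "d = \<bar>\<beta> - s\<bar>"
  define K where "K = (\<bar>\<beta>\<bar> + \<bar>of_int p\<bar>) / \<bar>c\<bar> + \<bar>s\<bar>"
  \<comment> \<open>\<open>K\<close> does not depend on \<open>L\<close>, so large \<open>L\<close>
    forces \<open>d = 0\<close>.\<close>
  have key: "d * I * real L \<le> 2 * M * K" for L :: nat
  proof -
    have "compact (\<rho> ` {0..real L + 1})"
      by (intro compact_continuous_image compact_Icc continuous_on_subset[OF cont\<rho>]) simp
    then have "bounded (\<rho> ` {0..real L + 1})"
      by (rule compact_imp_bounded)
    then obtain B where "\<forall>y\<in>\<rho> ` {0..real L + 1}. \<bar>y\<bar> \<le> B"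
      unfolding bounded_iff real_norm_def by (rule exE)
    then have B: "\<And>x. x \<in> {0..real L + 1} \<Longrightarrow> \<bar>\<rho> x\<bar> \<le> B"
      by simp
    \<comment> \<open>\<open>C\<close> collects the errors that do not grow with \<open>N\<close>:
      the bound on \<rho> over the interval, and the rounding of the index \<open>k\<close>.\<close>
    define C where "C = 2 * real L * B + I * real L * \<bar>of_int p\<bar>"
    have est: "real N * (d * I * real L) \<le> C + real N * (2 * M * K)" if "N > 0" for N :: nat
    proof -
      \<comment> \<open>\<open>n\<close> cancels the integer part of \<open>N * \<alpha>\<close>, so
        the total shift in the argument of \<rho> is \<theta>, in [0, 1), and
        \<open>z + \<theta>\<close> stays in [0, L + 1], where \<open>B\<close> bounds \<rho>. The
        index \<open>k\<close> then differs from \<open>N * \<beta>\<close> only by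
        \<open>p * \<theta>\<close>.\<close>
      define n where "n = - \<lfloor>real N * \<alpha>\<rfloor>"
      define k where "k = p * n + r * int N"
      define \<theta> where "\<theta> = frac (real N * \<alpha>)"
      have \<theta>: "0 \<le> \<theta>" "\<theta> < 1" "of_int n + real N * \<alpha> = \<theta>"
        using frac_lt_1[of "real N * \<alpha>"] by (simp_all add: \<theta>_def n_def) (simp add: frac_def)
      have k: "of_int k = real N * \<beta> + of_int p * \<theta>"
        unfolding k_def \<theta>(3)[symmetric] \<beta>_def by (simp add: algebra_simps)
      have p\<theta>: "\<bar>of_int p * \<theta>\<bar> \<le> \<bar>of_int p\<bar>"
        using \<theta> by (simp add: abs_mult mult_left_le)
      have kbound: "\<bar>of_int k\<bar> \<le> real N * (\<bar>\<beta>\<bar> + \<bar>of_int p\<bar>)"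
      proof -
        have "\<bar>of_int p\<bar> \<le> real N * \<bar>of_int p\<bar>" using that by (simp add: mult_le_cancel_right1)
        moreover have "\<bar>real N * \<beta>\<bar> = real N * \<bar>\<beta>\<bar>" by (simp add: abs_mult)
        ultimately show ?thesis
          using p\<theta> unfolding k distrib_left by linarith
      qed
      \<comment> \<open>\<open>Q\<close> is a primitive of the left side of the cohomological
        equation with \<open>m = N\<close>. Division by \<open>c\<close> undoes the chain rule, and
        the linear term restores the means removed from both cocycles.\<close>
      define Q where "Q x = cocycle \<alpha> P k (c * x + \<delta>) / c - s * cocycle \<alpha> P (int N) x
        + (of_int k - s * real N) * I * x" for x
      have dQ: "(Q has_field_derivative \<rho> x - \<rho> (x + \<theta>)) (at x)" for x
      proof -
        have "((\<lambda>x. cocycle \<alpha> P k (c * x + \<delta>)) has_field_derivative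
            (cocycle \<alpha> F k (c * x + \<delta>) - of_int k * I) * c) (at x)"
          by (rule DERIV_chain2[OF dP]) (auto intro!: derivative_eq_intros)
        from DERIV_cdivide[OF this, of c] have "((\<lambda>x. cocycle \<alpha> P k (c * x + \<delta>) / c) has_field_derivative
            cocycle \<alpha> F k (c * x + \<delta>) - of_int k * I) (at x)"
          using \<open>c \<noteq> 0\<close> by simp
        then have "(Q has_field_derivative
            (cocycle \<alpha> F k (c * x + \<delta>) - of_int k * I) - s * (cocycle \<alpha> F (int N) x - real N * I)
             + (of_int k - s * real N) * I) (at x)"
          unfolding Q_def
          by (intro DERIV_add DERIV_diff DERIV_cmult DERIV_cmult_Id) (use dP[of "int N" x] in simp_all)
        also have "(cocycle \<alpha> F k (c * x + \<delta>) - of_int k * I) - s * (cocycle \<alpha> F (int N) x - real N * I)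
             + (of_int k - s * real N) * I = cocycle \<alpha> F k (c * x + \<delta>) - s * cocycle \<alpha> F (int N) x"
          by (simp add: algebra_simps)
        also have "\<dots> = \<rho> x - \<rho> (x + \<theta>)"
          using coh[of n "int N" x] \<theta>(3) by (simp add: k_def add.assoc)
        finally show ?thesis .
      qed
      \<comment> \<open>The increment of \<open>Q\<close> is estimated in two ways: here through the
        right side of the equation, below through its explicit form, where the cocycles of the
        bounded \<open>P\<close> grow at most linearly in \<open>k\<close> and
        \<open>N\<close>.\<close>
      have "\<bar>Q (real L) - Q 0\<bar> \<le> 2 * B * real L"
      proof (cases "L = 0")
        case False
        then obtain z where z: "0 < z" "z < real L" "Q (real L) - Q 0 = real L * (\<rho> z - \<rho> (z + \<theta>))"
          using MVT2[of 0 "real L" Q "\<lambda>x. \<rho> x - \<rho> (x + \<theta>)"] dQ by auto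
        moreover have "\<bar>\<rho> z - \<rho> (z + \<theta>)\<bar> \<le> 2 * B"
          using B[of z] B[of "z + \<theta>"] z \<theta> by fastforce
        ultimately show ?thesis
          by (simp add: abs_mult mult.commute mult_left_mono)
      qed simp
      moreover have "\<bar>cocycle \<alpha> P k (c * real L + \<delta>) / c - cocycle \<alpha> P k \<delta> / c\<bar> \<le> 2 * (\<bar>of_int k\<bar> * M) / \<bar>c\<bar>"
      proof -
        have "\<bar>cocycle \<alpha> P k (c * real L + \<delta>) - cocycle \<alpha> P k \<delta>\<bar> \<le> 2 * (\<bar>of_int k\<bar> * M)"
          using cocycle_upper_bound[of P M \<alpha> k "c * real L + \<delta>", OF M] cocycle_upper_bound[of P M \<alpha> k \<delta>, OF M]
          by linarith
        then show ?thesis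
          by (simp add: diff_divide_distrib[symmetric] divide_right_mono)
      qed
      moreover have "\<bar>s * cocycle \<alpha> P (int N) (real L) - s * cocycle \<alpha> P (int N) 0\<bar> \<le> \<bar>s\<bar> * (2 * (real N * M))"
      proof -
        have "\<bar>cocycle \<alpha> P (int N) (real L) - cocycle \<alpha> P (int N) 0\<bar> \<le> 2 * (real N * M)"
          using cocycle_upper_bound[of P M \<alpha> "int N" "real L", OF M] cocycle_upper_bound[of P M \<alpha> "int N" 0, OF M]
          by simp
        then show ?thesis
          by (simp add: right_diff_distrib[symmetric] abs_mult mult_left_mono)
      qed
      moreover have "Q (real L) - Q 0 = (cocycle \<alpha> P k (c * real L + \<delta>) / c - cocycle \<alpha> P k \<delta> / c)
         - (s * cocycle \<alpha> P (int N) (real L) - s * cocycle \<alpha> P (int N) 0) + (of_int k - s * real N) * I * real L"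
        by (simp add: Q_def)
      ultimately have "\<bar>(of_int k - s * real N) * I * real L\<bar>
          \<le> 2 * B * real L + 2 * (\<bar>of_int k\<bar> * M) / \<bar>c\<bar> + \<bar>s\<bar> * (2 * (real N * M))"
        by linarith
      also have "2 * (\<bar>of_int k\<bar> * M) / \<bar>c\<bar> \<le> 2 * M * (real N * ((\<bar>\<beta>\<bar> + \<bar>of_int p\<bar>) / \<bar>c\<bar>))"
        using divide_right_mono[OF mult_left_mono[OF kbound, of "2 * M"], of "\<bar>c\<bar>"] \<open>M > 0\<close>
        by (simp add: mult_ac)
      finally have 1: "\<bar>(of_int k - s * real N) * I * real L\<bar> \<le> 2 * B * real L + real N * (2 * M * K)"
        by (simp add: K_def algebra_simps)
      have "real N * d - \<bar>of_int p\<bar> \<le> \<bar>of_int k - s * real N\<bar>"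
      proof -
        have "of_int k - s * real N = real N * (\<beta> - s) + of_int p * \<theta>"
          by (simp add: k algebra_simps)
        moreover have "\<bar>real N * (\<beta> - s)\<bar> = real N * d"
          by (simp add: d_def abs_mult)
        ultimately show ?thesis using p\<theta> by linarith
      qed
      from mult_right_mono[OF this, of "I * real L"] have
        "(real N * d - \<bar>of_int p\<bar>) * (I * real L) \<le> \<bar>(of_int k - s * real N) * I * real L\<bar>"
        using \<open>I > 0\<close> by (simp add: abs_mult mult.assoc)
      with 1 show ?thesis by (simp add: C_def algebra_simps)
    qed
    show ?thesis
    proof (rule ccontr)
      assume "\<not> ?thesis"
      then have "d * I * real L - 2 * M * K > 0" by simp
      then obtain N :: nat where N: "real N * (d * I * real L - 2 * M * K) > C"
        using reals_Archimedean3 by blast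
      \<comment> \<open>The estimate requires a positive index, while the Archimedean property may
        return zero.\<close>
      have "real (Suc N) * (d * I * real L - 2 * M * K) > C"
        using N \<open>d * I * real L - 2 * M * K > 0\<close> by (simp add: algebra_simps)
      with est[of "Suc N"] show False by (simp add: algebra_simps)
    qed
  qed
  have "d = 0"
  proof (rule ccontr)
    assume "d \<noteq> 0"
    then have "d * I > 0" using \<open>I > 0\<close> by (simp add: d_def)
    then obtain L :: nat where "real L * (d * I) > 2 * M * K"
      using reals_Archimedean3 by blast
    with key[of L] show False by (simp add: algebra_simps)
  qed
  then show ?thesis by (simp add: d_def \<beta>_def)
qed

text \<open>\<open>A\<close> and \<open>B\<close> are the matrices of multiplication by
  \<open>c\<close> and \<open>d\<close> on the group generated by 1 and \<alpha>, with the
  coordinates of images as columns. Their product is multiplication by 1, and coordinates are unique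
  because \<alpha> is irrational.\<close>

lemma matrix_mult_eq_1_of_mult_eq_1:
  fixes A B :: "int^2^2" and c d :: real
  assumes "\<alpha> \<notin> \<rat>"
    and A: "c = of_int (A$1$1) + of_int (A$2$1) * \<alpha>" "c * \<alpha> = of_int (A$1$2) + of_int (A$2$2) * \<alpha>"
    and B: "d = of_int (B$1$1) + of_int (B$2$1) * \<alpha>" "d * \<alpha> = of_int (B$1$2) + of_int (B$2$2) * \<alpha>"
    and "c * d = 1"
  shows "A ** B = mat 1"
proof -
  have *: "of_int (A$1$1 * i + A$1$2 * j) + of_int (A$2$1 * i + A$2$2 * j) * \<alpha> = c * (of_int i + of_int j * \<alpha>)"
    for i j :: int
  proof -
    have "c * (of_int i + of_int j * \<alpha>) = c * of_int i + of_int j * (c * \<alpha>)"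
      by (simp add: algebra_simps)
    then show ?thesis unfolding A(2) unfolding A(1) by (simp add: algebra_simps)
  qed
  have "c * (d * \<alpha>) = \<alpha>" using \<open>c * d = 1\<close> by (simp flip: mult.assoc)
  then have "of_int (A$1$1 * B$1$1 + A$1$2 * B$2$1) + of_int (A$2$1 * B$1$1 + A$2$2 * B$2$1) * \<alpha> = of_int 1 + of_int 0 * \<alpha>"
    "of_int (A$1$1 * B$1$2 + A$1$2 * B$2$2) + of_int (A$2$1 * B$1$2 + A$2$2 * B$2$2) * \<alpha> = of_int 0 + of_int 1 * \<alpha>"
    unfolding * B[symmetric] using \<open>c * d = 1\<close> by simp_all
  then show ?thesis
    unfolding add_of_int_mult_irrational_eq_iff[OF assms(1)]
    by (simp add: vec_eq_iff forall_2 matrix_matrix_mult_def sum_2 mat_def)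
qed

section \<open>The circle as a quotient of the line\<close>

lemma continuous_on_to_circle: "continuous_on UNIV to_circle"
  by (auto simp: continuous_on_open_vimage open_circle_def)

lemma to_circle_cases:
  obtains x where "c = to_circle x"
  by (induction c rule: circle.abs_induct) blast

text \<open>The saturation of \<open>A\<close> is the union of its integer translates.\<close>

lemma open_to_circle_image:
  assumes "open A"
  shows "open (to_circle ` A)"
proof -
  have "to_circle -` (to_circle ` A) = (\<Union>n::int. (\<lambda>x. x + of_int n) -` A)"
  proof (intro set_eqI iffI)
    fix x assume "x \<in> to_circle -` (to_circle ` A)"
    then obtain y n where "y \<in> A" "y = x + of_int n"
      by (auto simp: to_circle_eq_iff elim!: Ints_cases) (metis add.commute diff_add_cancel minus_diff_eq of_int_minus)
    then show "x \<in> (\<Union>n::int. (\<lambda>x. x + of_int n) -` A)" by auto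
  next
    fix x assume "x \<in> (\<Union>n::int. (\<lambda>x. x + of_int n) -` A)"
    then obtain n :: int where "x + of_int n \<in> A" by auto
    moreover have "to_circle x = to_circle (x + of_int n)"
      by (simp add: to_circle_eq_iff)
    ultimately show "x \<in> to_circle -` (to_circle ` A)" by auto
  qed
  moreover have "open (\<Union>n::int. (\<lambda>x. x + of_int n) -` A)"
    using assms by (intro open_UN ballI open_vimage continuous_intros)
  ultimately show ?thesis by (simp add: open_circle_def)
qed

text \<open>The product of a quotient map with an identity can fail to be a quotient map. Here
  \<open>to_circle\<close> is open, and openness passes to products through images of
  rectangles.\<close>

lemma quotient_map_to_circle_times:
  "quotient_map euclidean euclidean (\<lambda>p :: real \<times> 'a::topological_space. (to_circle (fst p), snd p))"
    (is "quotient_map _ _ ?f")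
proof (rule continuous_open_imp_quotient_map)
  have "continuous_on UNIV ?f"
    by (intro continuous_on_Pair continuous_on_compose2[OF continuous_on_to_circle] continuous_intros) auto
  then show "continuous_map euclidean euclidean ?f" by simp
  have "open (?f ` U)" if "open U" for U
    unfolding open_prod_def
  proof
    fix z assume "z \<in> ?f ` U"
    then obtain x r where xr: "(x, r) \<in> U" "z = (to_circle x, r)" by auto
    then obtain A B where "open A" "open B" "(x, r) \<in> A \<times> B" "A \<times> B \<subseteq> U"
      using open_prod_elim[OF \<open>open U\<close> xr(1)] by blast
    then have "z \<in> to_circle ` A \<times> B" "to_circle ` A \<times> B \<subseteq> ?f ` U"
      using xr by force+
    then show "\<exists>A B. open A \<and> open B \<and> z \<in> A \<times> B \<and> A \<times> B \<subseteq> ?f ` U"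
      using open_to_circle_image \<open>open A\<close> \<open>open B\<close> by blast
  qed
  then show "open_map euclidean euclidean ?f" by (simp add: open_map_def)
  have "(c, r) \<in> range ?f" for c r
  proof -
    obtain x where "c = to_circle x" by (rule to_circle_cases)
    then show ?thesis by (intro image_eqI[of _ _ "(x, r)"]) simp_all
  qed
  then show "?f ` topspace euclidean = topspace euclidean"
    by auto
qed

lemma to_circle_diff: "to_circle (x - y) = to_circle x - to_circle y"
  by (metis add_diff_cancel_right' diff_add_cancel to_circle_add)

lemma periodic_imp_periodic_lift:
  assumes "continuous_on UNIV g" "\<And>x. g (x + 1) = g x"
  obtains g' where "continuous_on UNIV g'" "\<And>x. g' (to_circle x) = g x"
proof -
  have "g x = g y" if "to_circle x = to_circle y" for x y
  proof -
    have "x - y \<in> \<int>" using that by (simp only: to_circle_eq_iff)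
    then obtain n where "x - y = of_int n" by (rule Ints_cases)
    then show ?thesis
      using periodic_of_int[of g y n, OF assms(2)] by (simp add: algebra_simps)
  qed
  then obtain g' where g': "g = g' \<circ> to_circle"
    using function_factors_left[of to_circle g] by blast
  have "open (g' -` U)" if "open U" for U
    using open_vimage[OF that assms(1)] by (simp add: open_circle_def g' vimage_comp)
  then have "continuous_on UNIV g'" by (simp add: continuous_on_open_vimage)
  with g' show ?thesis using that by simp
qed

section \<open>The special flow on a quotient of the plane\<close>

locale rotation_special_flow =
  fixes \<alpha> :: real and f :: "circle \<Rightarrow> real"
  assumes irrational: "\<alpha> \<notin> \<rat>"
    and continuous_roof: "continuous_on UNIV f"
    and roof_pos: "\<And>x. f x > 0"
begin

abbreviation F :: "real \<Rightarrow> real" where "F \<equiv> periodic_lift f"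

abbreviation X :: "(circle \<times> real) set topology" where "X \<equiv> special_space \<alpha> f"

text \<open>This is the universal covering of \<open>X\<close> by the plane, through the cylinder;
  the maps \<open>deck n m\<close> are its deck transformations.\<close>

definition proj :: "real \<times> real \<Rightarrow> (circle \<times> real) set" where
  "proj p = orbit_relation (skew \<alpha> f) `` {(to_circle (fst p), snd p)}"

definition deck :: "int \<Rightarrow> int \<Rightarrow> real \<times> real \<Rightarrow> real \<times> real" where
  "deck n m p = (fst p + of_int n + of_int m * \<alpha>, snd p - cocycle \<alpha> F m (fst p))"

lemma continuous_F: "continuous_on UNIV F"
  unfolding periodic_lift_def
  by (rule continuous_on_compose2[OF continuous_roof continuous_on_to_circle]) simp

lemma F_periodic: "F (x + 1) = F x"
proof -
  have "to_circle (x + 1) = to_circle x" by (simp add: to_circle_eq_iff)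
  then show ?thesis by (simp add: periodic_lift_def)
qed

lemma F_pos: "F x > 0"
  by (simp add: periodic_lift_def roof_pos)

lemma F_lower_bound:
  obtains c where "c > 0" "\<And>x. F x \<ge> c"
proof -
  have "compact (range F)"
    using periodic_compact_range[of F] continuous_F F_periodic by blast
  then obtain y where "\<And>x. F x \<ge> F y"
    using compact_attains_inf[of "range F"] by auto
  then show ?thesis using that[of "F y"] F_pos by blast
qed

lemma skew_to_circle: "skew \<alpha> f (to_circle x, r) = (to_circle (x + \<alpha>), r - F x)"
  by (simp add: skew_def rotation_def periodic_lift_def to_circle_add)

lemma skew_funpow:
  "(skew \<alpha> f ^^ n) (to_circle x, r) = (to_circle (x + real n * \<alpha>), r - cocycle \<alpha> F (int n) x)"
proof (induction n)
  case (Suc n)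
  have "cocycle \<alpha> F (int (Suc n)) x = cocycle \<alpha> F (int n) x + F (x + real n * \<alpha>)"
    using cocycle_Suc[of \<alpha> F "int n" x] by (simp add: add.commute)
  then show ?case
    by (simp add: Suc skew_to_circle algebra_simps)
qed simp

text \<open>Iterates of \<open>skew\<close> from \<open>p\<close> to \<open>q\<close> or from
  \<open>q\<close> to \<open>p\<close> account for the two signs of \<open>m\<close>; the integer
  \<open>n\<close> records the ambiguity in lifting a circle point to the line.\<close>

lemma proj_eq_iff: "proj p = proj q \<longleftrightarrow> (\<exists>n m. q = deck n m p)"
proof -
  obtain x r y w where pq: "p = (x, r)" "q = (y, w)" by (metis surj_pair)
  have eq: "proj p = proj q \<longleftrightarrow>
      (\<exists>k. (to_circle y, w) = (skew \<alpha> f ^^ k) (to_circle x, r) \<or> (to_circle x, r) = (skew \<alpha> f ^^ k) (to_circle y, w))"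
    using eq_equiv_class_iff[OF equiv_orbit_relation[OF bij_skew]]
    by (simp add: proj_def pq orbit_relation_iff[OF bij_skew])
  show ?thesis
  proof
    assume "proj p = proj q"
    then obtain k where "(to_circle y, w) = (skew \<alpha> f ^^ k) (to_circle x, r) \<or>
        (to_circle x, r) = (skew \<alpha> f ^^ k) (to_circle y, w)"
      unfolding eq by blast
    then show "\<exists>n m. q = deck n m p"
    proof
      assume "(to_circle y, w) = (skew \<alpha> f ^^ k) (to_circle x, r)"
      then have "y - (x + real k * \<alpha>) \<in> \<int>" and w: "w = r - cocycle \<alpha> F (int k) x"
        by (simp_all add: skew_funpow to_circle_eq_iff)
      then obtain n where "y - (x + real k * \<alpha>) = of_int n" by (auto elim: Ints_cases)
      with w have "q = deck n (int k) p"
        by (simp add: deck_def pq algebra_simps)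
      then show ?thesis by blast
    next
      assume "(to_circle x, r) = (skew \<alpha> f ^^ k) (to_circle y, w)"
      then have "x - (y + real k * \<alpha>) \<in> \<int>" and r: "r = w - cocycle \<alpha> F (int k) y"
        by (simp_all add: skew_funpow to_circle_eq_iff)
      then obtain n where n: "x - (y + real k * \<alpha>) = of_int n" by (auto elim: Ints_cases)
      \<comment> \<open>Reversing the sign of the index moves the base point back to
        \<open>y + n\<close>, and periodicity drops \<open>n\<close>.\<close>
      then have "cocycle \<alpha> F (- int k) x = - cocycle \<alpha> F (int k) y"
        using cocycle_periodic[of F \<alpha> "int k" y n, OF F_periodic]
        by (simp add: cocycle_uminus algebra_simps)
      with n r have "q = deck (- n) (- int k) p"
        by (simp add: deck_def pq algebra_simps)
      then show ?thesis by blast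
    qed
  next
    assume "\<exists>n m. q = deck n m p"
    then obtain n m where y: "y = x + of_int n + of_int m * \<alpha>" and w: "w = r - cocycle \<alpha> F m x"
      by (auto simp: deck_def pq)
    show "proj p = proj q"
    proof (cases "m \<ge> 0")
      case True
      then have "(to_circle y, w) = (skew \<alpha> f ^^ nat m) (to_circle x, r)"
        by (simp add: skew_funpow to_circle_eq_iff y w)
      then show ?thesis unfolding eq by blast
    next
      case False
      have "cocycle \<alpha> F (- m) y = - cocycle \<alpha> F m x"
        using cocycle_uminus[of \<alpha> F m y] cocycle_periodic[of F \<alpha> m x n, OF F_periodic]
        by (simp add: y)
      with False have "(to_circle x, r) = (skew \<alpha> f ^^ nat (- m)) (to_circle y, w)"
        by (simp add: skew_funpow to_circle_eq_iff w) (simp add: y)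
      then show ?thesis unfolding eq by blast
    qed
  qed
qed

lemma proj_deck [simp]: "proj (deck n m p) = proj p"
  by (rule sym) (auto simp: proj_eq_iff)

lemma continuous_on_deck: "continuous_on S (deck n m)"
  unfolding deck_def
  by (intro continuous_intros continuous_on_compose2[OF continuous_on_cocycle[OF continuous_F]]) auto

lemma quotient_map_proj: "quotient_map euclidean X proj"
proof -
  have eq: "proj = (\<lambda>x. orbit_relation (skew \<alpha> f) `` {x}) \<circ> (\<lambda>p. (to_circle (fst p), snd p))"
    by (auto simp: proj_def)
  show ?thesis
    unfolding special_space_def eq
    by (rule quotient_map_compose[OF quotient_map_to_circle_times quotient_map_quotient_topology])
qed

lemma topspace_X: "topspace X = range proj"
  using quotient_imp_surjective_map[OF quotient_map_proj] by simp

lemma proj_in_topspace [simp]: "proj p \<in> topspace X"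
  by (simp add: topspace_X)

lemma topspace_X_cases:
  assumes "z \<in> topspace X"
  obtains x r where "z = proj (x, r)"
  using assms unfolding topspace_X by auto

lemma special_flow_proj: "special_flow t (proj (x, r)) = proj (x, r + t)"
  by (simp add: proj_def special_flow_class vertical_flow_def)

text \<open>The saturation of \<open>U\<close> is the union of its preimages under the continuous
  maps \<open>deck n m\<close>.\<close>

lemma openin_proj_image:
  assumes "open U"
  shows "openin X (proj ` U)"
proof -
  have "{p. proj p \<in> proj ` U} = (\<Union>n m. deck n m -` U)"
  proof (intro set_eqI iffI)
    fix p assume "p \<in> {p. proj p \<in> proj ` U}"
    then obtain u where "u \<in> U" "proj p = proj u" by auto
    then show "p \<in> (\<Union>n m. deck n m -` U)" using proj_eq_iff[of p u] by auto
  next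
    fix p assume "p \<in> (\<Union>n m. deck n m -` U)"
    then obtain n m where "deck n m p \<in> U" by auto
    then show "p \<in> {p. proj p \<in> proj ` U}" using proj_deck by (metis imageI mem_Collect_eq)
  qed
  moreover have "open (\<Union>n m. deck n m -` U)"
    using assms continuous_on_deck by (intro open_UN ballI open_vimage) auto
  ultimately show ?thesis
    using quotient_map_proj unfolding quotient_map_def
    by (metis (no_types, lifting) Collect_cong UNIV_I image_mono open_openin subset_UNIV topspace_X topspace_euclidean)
qed

text \<open>A deck transformation with \<open>m\<close> nonzero moves heights by at least the
  minimum of the roof, and one with \<open>m = 0\<close> moves the line by an integer. Hence the
  radius \<open>min 1 c\<close> works at every point.\<close>

lemma proj_locally_inj:
  obtains e where "e > 0" "\<And>p q. dist p q < e \<Longrightarrow> proj p = proj q \<Longrightarrow> p = q"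
proof -
  obtain c where c: "c > 0" "\<And>x. F x \<ge> c"
    using F_lower_bound by metis
  show ?thesis
  proof
    show "min 1 c > 0" using c by simp
    fix p q assume d: "dist p q < min 1 c" and "proj p = proj q"
    then obtain n m where q: "q = deck n m p" using proj_eq_iff by blast
    have dist: "\<bar>fst p - fst q\<bar> < 1" "\<bar>snd p - snd q\<bar> < c"
      using d dist_fst_le[of p q] dist_snd_le[of p q] by (auto simp: dist_real_def)
    have "\<bar>of_int m\<bar> * c \<le> \<bar>cocycle \<alpha> F m (fst p)\<bar>"
      using cocycle_lower_bound[of c F m \<alpha> "fst p"] c by simp
    also have "\<dots> < c" using dist(2) by (simp add: q deck_def)
    finally have "\<bar>of_int m :: real\<bar> < 1" using c(1) by simp
    then have "m = 0" by linarith
    with dist(1) have "\<bar>of_int n :: real\<bar> < 1" by (simp add: q deck_def)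
    then have "n = 0" by linarith
    with \<open>m = 0\<close> show "p = q" by (simp add: q deck_def)
  qed
qed

section \<open>Lifting paths from \<open>X\<close> to the plane\<close>

definition lifts :: "(real \<Rightarrow> (circle \<times> real) set) \<Rightarrow> real set \<Rightarrow> (real \<Rightarrow> real \<times> real) \<Rightarrow> bool" where
  "lifts \<gamma> S l \<longleftrightarrow> continuous_on S l \<and> (\<forall>t\<in>S. proj (l t) = \<gamma> t)"

lemma lifts_subset: "lifts \<gamma> S l \<Longrightarrow> T \<subseteq> S \<Longrightarrow> lifts \<gamma> T l"
  unfolding lifts_def using continuous_on_subset by blast

text \<open>On a ball of half the injectivity radius the open map \<open>proj\<close> has a
  continuous inverse branch; composing it with \<gamma> gives the lift.\<close>

lemma lifts_local:
  assumes "continuous_map euclidean X \<gamma>"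
  obtains d l where "d > 0" "lifts \<gamma> (ball t d) l"
proof -
  obtain e where e: "e > 0" "\<And>p q. dist p q < e \<Longrightarrow> proj p = proj q \<Longrightarrow> p = q"
    using proj_locally_inj by metis
  have "\<gamma> t \<in> topspace X"
    using continuous_map_image_subset_topspace[OF assms] by auto
  then obtain x r where p: "\<gamma> t = proj (x, r)"
    by (rule topspace_X_cases)
  define W where "W = ball (x, r) (e / 2)"
  have inj: "p = q" if "p \<in> W" "q \<in> W" "proj p = proj q" for p q
  proof (rule e(2))
    show "dist p q < e"
      using that(1,2) unfolding W_def mem_ball by (rule dist_triangle_half_r)
  qed fact
  have pre: "open {u. \<gamma> u \<in> proj ` U}" if "open U" for U
    using openin_continuous_map_preimage[OF assms openin_proj_image[OF that]] by simp
  define S where "S = {u. \<gamma> u \<in> proj ` W}"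
  define l where "l u = (THE w. w \<in> W \<and> proj w = \<gamma> u)" for u
  have l_eq: "l u = w" if "w \<in> W" "proj w = \<gamma> u" for u w
    unfolding l_def using that inj by (intro the_equality) auto
  have "open S" unfolding S_def W_def by (rule pre) simp
  moreover have "t \<in> S" using e(1) p by (auto simp: S_def W_def)
  ultimately obtain d where d: "d > 0" "ball t d \<subseteq> S"
    by (meson openE)
  have "continuous_on S l"
    unfolding continuous_on_open_vimage[OF \<open>open S\<close>]
  proof (intro allI impI)
    fix B :: "(real \<times> real) set" assume "open B"
    \<comment> \<open>Continuity of the inverse branch is openness of \<open>proj\<close>: the
      preimage of \<open>B\<close> becomes the preimage under \<gamma> of an open set.\<close>
    have "l -` B \<inter> S = {u. \<gamma> u \<in> proj ` (W \<inter> B)}"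
    proof (intro set_eqI iffI)
      fix u assume "u \<in> l -` B \<inter> S"
      then obtain w where "w \<in> W" "proj w = \<gamma> u" "l u \<in> B" by (auto simp: S_def)
      then show "u \<in> {u. \<gamma> u \<in> proj ` (W \<inter> B)}" using l_eq[of w u] by (auto intro!: image_eqI[of _ _ w])
    next
      fix u assume "u \<in> {u. \<gamma> u \<in> proj ` (W \<inter> B)}"
      then obtain w where "w \<in> W" "w \<in> B" "proj w = \<gamma> u" by auto
      then show "u \<in> l -` B \<inter> S" using l_eq[of w u] by (auto simp: S_def intro!: image_eqI[of _ _ w])
    qed
    then show "open (l -` B \<inter> S)"
      using pre[of "W \<inter> B"] \<open>open B\<close> by (simp add: W_def open_Int)
  qed
  moreover have "proj (l u) = \<gamma> u" if "u \<in> S" for u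
    using that l_eq by (auto simp: S_def)
  ultimately have "lifts \<gamma> S l" by (simp add: lifts_def)
  then show ?thesis using that d lifts_subset by blast
qed

lemma lifts_glue:
  assumes "lifts \<gamma> {a..b} l" "lifts \<gamma> {b..c} k" "l b = k b" "a \<le> b" "b \<le> c"
  shows "lifts \<gamma> {a..c} (\<lambda>t. if t \<le> b then l t else k t)"
proof -
  have "continuous_on {a..c} (\<lambda>t. if t \<le> b then l t else k t)"
    using assms by (intro continuous_on_cases_le)
      (auto simp: lifts_def intro: continuous_on_subset)
  then show ?thesis using assms by (auto simp: lifts_def)
qed

lemma lifts_deck: "lifts \<gamma> S l \<Longrightarrow> lifts \<gamma> S (\<lambda>t. deck n m (l t))"
  by (auto simp: lifts_def intro: continuous_on_compose2[OF continuous_on_deck[of UNIV]])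

text \<open>Both lifts meet the same fibre at \<open>b\<close>, so a deck transformation makes them
  agree there. It is applied to the new piece, so that the old lift is truly extended.\<close>

lemma lifts_extend_right:
  assumes "lifts \<gamma> {a..b} l" "lifts \<gamma> {b..c} k" "a \<le> b" "b \<le> c"
  obtains l' where "lifts \<gamma> {a..c} l'" "\<And>t. t \<le> b \<Longrightarrow> l' t = l t"
proof -
  have "proj (k b) = proj (l b)" using assms by (simp add: lifts_def)
  then obtain n m where "l b = deck n m (k b)" using proj_eq_iff by blast
  then have "lifts \<gamma> {a..c} (\<lambda>t. if t \<le> b then l t else deck n m (k t))"
    using lifts_glue[OF assms(1) lifts_deck[OF assms(2)] _ assms(3,4)] by blast
  then show ?thesis by (rule that) simp
qed

lemma lifts_extend_left:
  assumes "lifts \<gamma> {a..b} k" "lifts \<gamma> {b..c} l" "a \<le> b" "b \<le> c"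
  obtains l' where "lifts \<gamma> {a..c} l'" "\<And>t. b \<le> t \<Longrightarrow> l' t = l t"
proof -
  have "proj (k b) = proj (l b)" using assms by (simp add: lifts_def)
  then obtain n m where eq: "l b = deck n m (k b)" using proj_eq_iff by blast
  let ?l = "\<lambda>t. if t \<le> b then deck n m (k t) else l t"
  have "lifts \<gamma> {a..c} ?l"
    using lifts_glue[OF lifts_deck[OF assms(1)] assms(2) _ assms(3,4)] eq by simp
  moreover have "?l t = l t" if "b \<le> t" for t using that eq by auto
  ultimately show ?thesis using that by blast
qed

text \<open>Bisection applies: intervals with a lift can be concatenated, and every point has a
  neighbourhood with a lift.\<close>

lemma lifts_interval:
  assumes \<gamma>: "continuous_map euclidean X \<gamma>" and "a \<le> b"
  shows "\<exists>l. lifts \<gamma> {a..b} l"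
  using \<open>a \<le> b\<close>
proof (induction rule: Bolzano)
  case (trans a b c)
  then obtain l k where "lifts \<gamma> {a..b} l" "lifts \<gamma> {b..c} k" by blast
  from lifts_extend_right[OF this trans(3,4)] show ?case by blast
next
  case (local x)
  obtain d l where "d > 0" "lifts \<gamma> (ball x d) l"
    using lifts_local[OF \<gamma>] by metis
  moreover have "lifts \<gamma> {a..b} l" if "a \<le> x" "x \<le> b" "b - a < d" for a b
    by (rule lifts_subset[OF \<open>lifts \<gamma> (ball x d) l\<close>]) (use that in \<open>auto simp: dist_real_def\<close>)
  ultimately show ?case by (intro exI[of _ d]) auto
qed

text \<open>Lifts are not unique, so lifts over the intervals [-N, N] chosen independently need not
  agree. Dependent choice makes each one extend its predecessor.\<close>

lemma lifts_line:
  assumes \<gamma>: "continuous_map euclidean X \<gamma>"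
  obtains l where "lifts \<gamma> UNIV l"
proof -
  have base: "\<exists>l. lifts \<gamma> {- real 0..real 0} l"
    by (rule lifts_interval[OF \<gamma>]) simp
  have step: "\<exists>l'. lifts \<gamma> {- real (Suc N)..real (Suc N)} l' \<and> (\<forall>t\<in>{- real N..real N}. l' t = l t)"
    if l: "lifts \<gamma> {- real N..real N} l" for l N
  proof -
    have "\<exists>k. lifts \<gamma> {real N..real (Suc N)} k" "\<exists>k. lifts \<gamma> {- real (Suc N)..- real N} k"
      by (rule lifts_interval[OF \<gamma>]; simp)+
    then obtain k k' where k: "lifts \<gamma> {real N..real (Suc N)} k"
      and k': "lifts \<gamma> {- real (Suc N)..- real N} k'" by blast
    obtain l1 where l1: "lifts \<gamma> {- real N..real (Suc N)} l1" "\<And>t. t \<le> real N \<Longrightarrow> l1 t = l t"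
      by (rule lifts_extend_right[OF l k]) auto
    obtain l2 where l2: "lifts \<gamma> {- real (Suc N)..real (Suc N)} l2" "\<And>t. - real N \<le> t \<Longrightarrow> l2 t = l1 t"
      by (rule lifts_extend_left[OF k' l1(1)]) auto
    have "\<forall>t\<in>{- real N..real N}. l2 t = l t" using l1(2) l2(2) by simp
    with l2(1) show ?thesis by blast
  qed
  obtain L where L: "\<And>N. lifts \<gamma> {- real N..real N} (L N)"
    and LS: "\<And>N t. t \<in> {- real N..real N} \<Longrightarrow> L (Suc N) t = L N t"
    using dependent_nat_choice[of "\<lambda>N. lifts \<gamma> {- real N..real N}"
        "\<lambda>N l l'. \<forall>t\<in>{- real N..real N}. l' t = l t", OF base step] by metis
  have LM: "L M t = L N t" if "N \<le> M" "t \<in> {- real N..real N}" for M N t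
    using that(1)
  proof (induction M rule: dec_induct)
    case (step M)
    then show ?case using LS[of t M] that(2) by auto
  qed simp
  \<comment> \<open>By \<open>LM\<close> every \<open>N\<close> with
    \<open>\<bar>t\<bar> \<le> N\<close> gives the same value; the ceiling merely selects
    one.\<close>
  define l where "l t = L (nat \<lceil>\<bar>t\<bar>\<rceil>) t" for t
  have l: "l t = L N t" if "t \<in> {- real N..real N}" for t N
  proof -
    have "t \<in> {- real (nat \<lceil>\<bar>t\<bar>\<rceil>)..real (nat \<lceil>\<bar>t\<bar>\<rceil>)}" by simp linarith
    then show ?thesis
      unfolding l_def using LM that by (metis nat_le_linear)
  qed
  have "isCont l t" for t
  proof -
    obtain N where "\<bar>t\<bar> < real N" using reals_Archimedean2 by blast
    then have "t \<in> {- real N<..<real N}" by auto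
    moreover have "continuous_on {- real N<..<real N} l"
    proof (rule continuous_on_eq)
      show "continuous_on {- real N<..<real N} (L N)"
        using L[of N] unfolding lifts_def by (auto intro: continuous_on_subset)
    qed (simp add: l[where N = N])
    ultimately show ?thesis
      by (metis continuous_on_eq_continuous_at open_greaterThanLessThan)
  qed
  moreover have "proj (l t) = \<gamma> t" for t
  proof -
    obtain N where "\<bar>t\<bar> < real N" using reals_Archimedean2 by blast
    then have "t \<in> {- real N..real N}" by auto
    then show ?thesis using l[of t N] L[of N] by (simp add: lifts_def)
  qed
  ultimately have "lifts \<gamma> UNIV l"
    by (simp add: lifts_def continuous_at_imp_continuous_on)
  then show ?thesis by (rule that)
qed

section \<open>Conjugacies and cohomological equations\<close>

text \<open>
  Along the flow an intertwiner is a translation, so it suffices to lift the image of the section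
  \<open>r = 0\<close>. The horizontal component of the lift differs at points of the same fibre by elements of
  the countable group \<open>\<int> + \<alpha>\<int>\<close>, hence by constants, hence it is affine.
\<close>

lemma intertwiner_lift:
  assumes h: "continuous_map X X h"
    and flow: "\<And>t z. z \<in> topspace X \<Longrightarrow> h (special_flow t z) = special_flow (s * t) (h z)"
  obtains c \<delta> \<rho> and a11 a12 a21 a22 :: int where
    "continuous_on UNIV \<rho>"
    "\<And>x r. h (proj (x, r)) = proj (c * x + \<delta>, s * r + \<rho> x)"
    "c = of_int a11 + of_int a21 * \<alpha>" "c * \<alpha> = of_int a12 + of_int a22 * \<alpha>"
    "\<And>m n x. cocycle \<alpha> F (a21 * n + a22 * m) (c * x + \<delta>) - s * cocycle \<alpha> F m x
       = \<rho> x - \<rho> (x + of_int n + of_int m * \<alpha>)"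
proof -
  have "continuous_map euclidean X (\<lambda>x. proj (x, 0 :: real))"
  proof -
    have "continuous_map euclidean euclidean (\<lambda>x :: real. (x, 0 :: real))"
      by (simp add: continuous_on_Pair)
    from continuous_map_compose[OF this quotient_imp_continuous_map[OF quotient_map_proj]]
    show ?thesis by (simp add: o_def)
  qed
  from continuous_map_compose[OF this h]
  have "continuous_map euclidean X (\<lambda>x. h (proj (x, 0)))"
    by (simp add: o_def)
  then obtain l where l: "lifts (\<lambda>x. h (proj (x, 0))) UNIV l"
    by (rule lifts_line)
  define \<phi> where "\<phi> x = fst (l x)" for x
  define \<rho> where "\<rho> x = snd (l x)" for x
  have cont\<phi>: "continuous_on UNIV \<phi>" and cont\<rho>: "continuous_on UNIV \<rho>"
    using l unfolding lifts_def \<phi>_def \<rho>_def by (auto intro: continuous_on_fst continuous_on_snd)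
  have h0: "h (proj (x, 0)) = proj (\<phi> x, \<rho> x)" for x
    using l by (simp add: lifts_def \<phi>_def \<rho>_def)
  have hproj: "h (proj (x, r)) = proj (\<phi> x, s * r + \<rho> x)" for x r
    using flow[of "proj (x, 0)" r] by (simp add: special_flow_proj h0 add.commute)
  \<comment> \<open>Two lifts of one point of \<open>X\<close> differ by a deck transformation. At
    this stage \<open>n'\<close> and \<open>m'\<close> may vary with \<open>x\<close>.\<close>
  have equiv: "\<exists>n' m'. \<phi> (x + of_int n + of_int m * \<alpha>) = \<phi> x + of_int n' + of_int m' * \<alpha>
      \<and> \<rho> (x + of_int n + of_int m * \<alpha>) - s * cocycle \<alpha> F m x = \<rho> x - cocycle \<alpha> F m' (\<phi> x)" for n m x
  proof -
    have "proj (x, 0) = proj (deck n m (x, 0))" by simp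
    then have "h (proj (x, 0)) = h (proj (x + of_int n + of_int m * \<alpha>, - cocycle \<alpha> F m x))"
      by (simp add: deck_def)
    then have "proj (\<phi> x, \<rho> x) = proj (\<phi> (x + of_int n + of_int m * \<alpha>),
        s * (- cocycle \<alpha> F m x) + \<rho> (x + of_int n + of_int m * \<alpha>))"
      unfolding hproj by simp
    then obtain n' m' where "(\<phi> (x + of_int n + of_int m * \<alpha>),
        s * (- cocycle \<alpha> F m x) + \<rho> (x + of_int n + of_int m * \<alpha>)) = deck n' m' (\<phi> x, \<rho> x)"
      unfolding proj_eq_iff by blast
    then show ?thesis
      by (intro exI[of _ n'] exI[of _ m']) (simp add: deck_def)
  qed
  have const: "\<phi> (x + of_int n + of_int m * \<alpha>) - \<phi> x = \<phi> (0 + of_int n + of_int m * \<alpha>) - \<phi> 0" for n m :: int and x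
  proof (rule continuous_int_translate_image_constant[where u = "\<lambda>x. \<phi> (x + of_int n + of_int m * \<alpha>) - \<phi> x"])
    show "continuous_on UNIV (\<lambda>x. \<phi> (x + of_int n + of_int m * \<alpha>) - \<phi> x)"
      by (intro continuous_intros cont\<phi> continuous_on_compose2[OF cont\<phi>]) auto
    show "\<exists>n' m' :: int. \<phi> (x + of_int n + of_int m * \<alpha>) - \<phi> x = of_int n' + of_int m' * \<alpha>" for x
    proof -
      obtain n' m' where "\<phi> (x + of_int n + of_int m * \<alpha>) = \<phi> x + of_int n' + of_int m' * \<alpha>"
        using equiv[where n = n and m = m and x = x] by auto
      then show ?thesis by (intro exI[of _ n'] exI[of _ m']) simp
    qed
  qed
  define c where "c = \<phi> (0 + of_int 1 + of_int 0 * \<alpha>) - \<phi> 0"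
  define d where "d = \<phi> (0 + of_int 0 + of_int 1 * \<alpha>) - \<phi> 0"
  define \<delta> where "\<delta> = \<phi> 0"
  have one: "\<phi> (x + 1) = \<phi> x + c" for x
    using const[of x 1 0] by (simp add: c_def)
  have alpha: "\<phi> (x + \<alpha>) = \<phi> x + d" for x
    using const[of x 0 1] by (simp add: d_def)
  note affine = quasi_periodic_affine[OF irrational cont\<phi> one alpha, folded \<delta>_def]
  obtain a11 a21 :: int where c: "c = of_int a11 + of_int a21 * \<alpha>"
    using equiv[where n = 1 and m = 0 and x = 0] by (auto simp: c_def)
  obtain a12 a22 :: int where d: "d = of_int a12 + of_int a22 * \<alpha>"
    using equiv[where n = 0 and m = 1 and x = 0] by (auto simp: d_def)
  have coh: "cocycle \<alpha> F (a21 * n + a22 * m) (c * x + \<delta>) - s * cocycle \<alpha> F m x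
       = \<rho> x - \<rho> (x + of_int n + of_int m * \<alpha>)" for m n x
  proof -
    obtain n' m' where \<phi>: "\<phi> (x + of_int n + of_int m * \<alpha>) = \<phi> x + of_int n' + of_int m' * \<alpha>"
      and \<rho>: "\<rho> (x + of_int n + of_int m * \<alpha>) - s * cocycle \<alpha> F m x = \<rho> x - cocycle \<alpha> F m' (\<phi> x)"
      using equiv[where n = n and m = m and x = x] by auto
    \<comment> \<open>Now that \<phi> is affine, its displacement is linear in \<open>n\<close> and
      \<open>m\<close>; uniqueness of coordinates reads off \<open>m'\<close> from the second row of
      the matrix.\<close>
    have "of_int n' + of_int m' * \<alpha> = c * of_int n + of_int m * (c * \<alpha>)"
      using \<phi> unfolding affine(1) by (simp add: algebra_simps)
    also have "c * of_int n + of_int m * (c * \<alpha>) = of_int (a11 * n + a12 * m) + of_int (a21 * n + a22 * m) * \<alpha>"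
      unfolding affine(2)[symmetric] d unfolding c by (simp add: algebra_simps)
    finally have "m' = a21 * n + a22 * m"
      using add_of_int_mult_irrational_eq_iff[OF irrational] by blast
    with \<rho> show ?thesis by (simp add: affine(1))
  qed
  show ?thesis
  proof (rule that[OF cont\<rho> _ c _ coh])
    show "h (proj (x, r)) = proj (c * x + \<delta>, s * r + \<rho> x)" for x r
      unfolding hproj affine(1) ..
    show "c * \<alpha> = of_int a12 + of_int a22 * \<alpha>" using d affine(2) by simp
  qed
qed

text \<open>Only the preservation of fibres is asked, which admits maps that are equivariant up to
  an automorphism of the deck group.\<close>

lemma equivariant_map_descends:
  fixes H :: "real \<times> real \<Rightarrow> real \<times> real"
  assumes "continuous_on UNIV H" "\<And>n m p. proj (H (deck n m p)) = proj (H p)"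
  obtains h where "continuous_map X X h" "\<And>p. h (proj p) = proj (H p)"
proof -
  have "continuous_map euclidean euclidean H" using assms(1) by simp
  from continuous_map_compose[OF this quotient_imp_continuous_map[OF quotient_map_proj]]
  have "continuous_map euclidean X (\<lambda>p. proj (H p))" by (simp add: o_def)
  moreover have "proj (H p) = proj (H q)" if "proj p = proj q" for p q
  proof -
    obtain n m where "q = deck n m p" using \<open>proj p = proj q\<close> unfolding proj_eq_iff by blast
    then show ?thesis by (simp only: assms(2))
  qed
  ultimately show ?thesis
    by (rule quotient_map_lift_exists[OF quotient_map_proj]) (use that in auto)
qed

text \<open>The conjugacy and its inverse are both lifted. Their slopes are reciprocal, so their
  integer matrices are inverse to each other, and averaging the equation of the inverse identifies
  \<open>inverse s\<close>.\<close>

lemma conjugate_imp_cohomologous: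
  assumes "s \<in> I_top X special_flow"
  obtains A :: "int^2^2" and \<delta> g where
    "invertible A" "continuous_on UNIV g"
    "of_int (A$1$2) + of_int (A$2$2) * \<alpha> = (of_int (A$1$1) + of_int (A$2$1) * \<alpha>) * \<alpha>"
    "of_int (A$1$1) + of_int (A$2$1) * \<alpha> = of_int (det A) * s"
    "s = inverse (of_int (A$2$2) - of_int (A$2$1) * \<alpha>)"
    "\<And>m n x. s * cocycle \<alpha> F (A$2$1 * n + A$2$2 * m) (of_int (det A) * s * x + \<delta>) - cocycle \<alpha> F m x
       = g x - g (x + of_int n + of_int m * \<alpha>)"
proof -
  from assms have "s \<noteq> 0" and "topologically_conjugate X special_flow X (\<lambda>t. special_flow (s * t))"
    by (auto simp: I_top_def)
  then obtain h where hm: "homeomorphic_map X X h"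
    and h: "\<And>t z. z \<in> topspace X \<Longrightarrow> h (special_flow t z) = special_flow (s * t) (h z)"
    unfolding topologically_conjugate_def by blast
  from hm obtain k where "homeomorphic_maps X X h k"
    unfolding homeomorphic_map_maps by blast
  then have conth: "continuous_map X X h" and contk: "continuous_map X X k"
    and kh: "\<And>z. z \<in> topspace X \<Longrightarrow> k (h z) = z" and hk: "\<And>z. z \<in> topspace X \<Longrightarrow> h (k z) = z"
    by (auto simp: homeomorphic_maps_def)
  have flow_top: "special_flow t z \<in> topspace X" if "z \<in> topspace X" for t z
    using that by (rule topspace_X_cases) (simp add: special_flow_proj)
  have k: "k (special_flow t z) = special_flow (inverse s * t) (k z)" if z: "z \<in> topspace X" for t z
  proof -
    have kz: "k z \<in> topspace X"
      using z continuous_map_image_subset_topspace[OF contk] by auto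
    have "h (special_flow (inverse s * t) (k z)) = special_flow t z"
      using h[OF kz, of "inverse s * t"] hk[OF z] \<open>s \<noteq> 0\<close> by (simp flip: mult.assoc)
    then show ?thesis
      using kh[OF flow_top[OF kz], of "inverse s * t"] by simp
  qed
  obtain c1 \<delta>1 \<rho>1 and b11 b12 b21 b22 :: int where
    H: "\<And>x r. h (proj (x, r)) = proj (c1 * x + \<delta>1, s * r + \<rho>1 x)"
    and c1: "c1 = of_int b11 + of_int b21 * \<alpha>" "c1 * \<alpha> = of_int b12 + of_int b22 * \<alpha>"
    using intertwiner_lift[OF conth h] by metis
  obtain c \<delta> \<rho> and a11 a12 a21 a22 :: int where
    cont\<rho>: "continuous_on UNIV \<rho>"
    and K: "\<And>x r. k (proj (x, r)) = proj (c * x + \<delta>, inverse s * r + \<rho> x)"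
    and c: "c = of_int a11 + of_int a21 * \<alpha>" "c * \<alpha> = of_int a12 + of_int a22 * \<alpha>"
    and coh: "\<And>m n x. cocycle \<alpha> F (a21 * n + a22 * m) (c * x + \<delta>) - inverse s * cocycle \<alpha> F m x
       = \<rho> x - \<rho> (x + of_int n + of_int m * \<alpha>)"
    using intertwiner_lift[OF contk k] by metis
  \<comment> \<open>The composite of the two lifts covers the identity, so its horizontal
    displacement \<open>u\<close> takes values in a countable group and is constant. The composite
    therefore has slope 1.\<close>
  have cc1: "c * c1 = 1"
  proof -
    define u where "u x = c * (c1 * x + \<delta>1) + \<delta> - x" for x
    have "u 1 = u 0"
    proof (rule continuous_int_translate_image_constant[where u = u])
      show "continuous_on UNIV u" unfolding u_def by (intro continuous_intros)
      fix x
      have "proj (x, 0) = proj (c * (c1 * x + \<delta>1) + \<delta>, inverse s * (s * 0 + \<rho>1 x) + \<rho> (c1 * x + \<delta>1))"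
        using kh[of "proj (x, 0)"] unfolding H K by simp
      then obtain n m where "c * (c1 * x + \<delta>1) + \<delta> = x + of_int n + of_int m * \<alpha>"
        unfolding proj_eq_iff deck_def by auto
      then show "\<exists>n m :: int. u x = of_int n + of_int m * \<alpha>"
        by (intro exI[of _ n] exI[of _ m]) (simp add: u_def)
    qed
    then show ?thesis by (simp add: u_def algebra_simps)
  qed
  then have "c \<noteq> 0" by auto
  define A :: "int^2^2" where "A = vector [vector [a11, a12], vector [a21, a22]]"
  define B :: "int^2^2" where "B = vector [vector [b11, b12], vector [b21, b22]]"
  have A: "A$1$1 = a11" "A$1$2 = a12" "A$2$1 = a21" "A$2$2 = a22" by (simp_all add: A_def)
  have B: "B$1$1 = b11" "B$1$2 = b12" "B$2$1 = b21" "B$2$2 = b22" by (simp_all add: B_def)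
  have AB: "A ** B = mat 1"
    by (rule matrix_mult_eq_1_of_mult_eq_1[OF irrational, of c A c1 B, unfolded A B, OF c c1 cc1])
  have BA: "B ** A = mat 1"
    by (rule matrix_mult_eq_1_of_mult_eq_1[OF irrational, of c1 B c A, unfolded A B, OF c1 c])
      (rule trans[OF mult.commute cc1])
  have s: "of_int a22 - of_int a21 * \<alpha> = inverse s"
    by (rule time_change_eq_of_cohomologous[OF continuous_F F_periodic F_pos \<open>c \<noteq> 0\<close> cont\<rho> coh])
  \<comment> \<open>Expanding \<open>c * (a22 - a21 * \<alpha>)\<close> through both expressions for
    \<open>c\<close> and \<open>c * \<alpha>\<close>, the terms with \<alpha> cancel and the
    determinant remains.\<close>
  have "c * inverse s = of_int (det A)"
  proof -
    have "c * inverse s = c * of_int a22 - of_int a21 * (c * \<alpha>)"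
      unfolding s[symmetric] by (simp add: algebra_simps)
    then show ?thesis
      unfolding c(2) unfolding c(1) by (simp add: det_2 A algebra_simps)
  qed
  then have cs: "c = of_int (det A) * s"
    using \<open>s \<noteq> 0\<close> by (simp add: field_simps)
  have "invertible A" unfolding invertible_def using AB BA by blast
  show ?thesis
  \<comment> \<open>Multiplying the equation of the inverse by \<open>s\<close> moves the factor to
    the other cocycle, so the transfer function is \<open>s * \<rho>\<close>.\<close>
  proof (rule that[OF \<open>invertible A\<close>, of "\<lambda>x. s * \<rho> x" \<delta>])
    show "continuous_on UNIV (\<lambda>x. s * \<rho> x)" by (intro continuous_intros cont\<rho>)
    show "of_int (A$1$2) + of_int (A$2$2) * \<alpha> = (of_int (A$1$1) + of_int (A$2$1) * \<alpha>) * \<alpha>"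
      using c by (simp add: A)
    show "of_int (A$1$1) + of_int (A$2$1) * \<alpha> = of_int (det A) * s"
      using c(1) cs by (simp add: A)
    show "s = inverse (of_int (A$2$2) - of_int (A$2$1) * \<alpha>)"
      using s by (simp add: A)
    show "s * cocycle \<alpha> F (A$2$1 * n + A$2$2 * m) (of_int (det A) * s * x + \<delta>) - cocycle \<alpha> F m x
       = s * \<rho> x - s * \<rho> (x + of_int n + of_int m * \<alpha>)" for m n x
      using arg_cong[OF coh[of n m x], of "\<lambda>y. s * y"] \<open>s \<noteq> 0\<close>
      unfolding A cs[symmetric] by (simp add: algebra_simps)
  qed
qed

text \<open>The equation says that the skew affine map \<open>H\<close> of the plane carries the
  deck action to itself twisted by \<open>A\<close>. Invertibility of \<open>A\<close> over the
  integers gives the same for its inverse \<open>K\<close>, so both descend.\<close>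

lemma cohomologous_imp_conjugate:
  fixes A :: "int^2^2"
  assumes "s \<noteq> 0" "invertible A" and contg: "continuous_on UNIV g"
    and c\<alpha>: "of_int (A$1$2) + of_int (A$2$2) * \<alpha> = (of_int (A$1$1) + of_int (A$2$1) * \<alpha>) * \<alpha>"
    and c: "of_int (A$1$1) + of_int (A$2$1) * \<alpha> = of_int (det A) * s"
    and coh: "\<And>m n x. s * cocycle \<alpha> F (A$2$1 * n + A$2$2 * m) (of_int (det A) * s * x + \<delta>) - cocycle \<alpha> F m x
       = g x - g (x + of_int n + of_int m * \<alpha>)"
  shows "s \<in> I_top X special_flow"
proof -
  obtain B where AB: "A ** B = mat 1"
    using \<open>invertible A\<close> unfolding invertible_def by blast
  then have "det A * det B = 1" by (metis det_mul det_I)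
  define c where "c = of_int (det A) * s"
  have "det A \<noteq> 0" using \<open>det A * det B = 1\<close> by auto
  then have "c \<noteq> 0" using \<open>s \<noteq> 0\<close> by (simp add: c_def)
  define H where "H p = (c * fst p + \<delta>, inverse s * (snd p + g (fst p)))" for p :: "real \<times> real"
  define K where "K p = ((fst p - \<delta>) / c, s * snd p - g ((fst p - \<delta>) / c))" for p :: "real \<times> real"
  have KH: "K (H p) = p" and HK: "H (K p) = p" for p
    using \<open>s \<noteq> 0\<close> \<open>c \<noteq> 0\<close> by (simp_all add: H_def K_def flip: mult.assoc)
  have contH: "continuous_on UNIV H"
    unfolding H_def by (intro continuous_intros continuous_on_compose2[OF contg]) auto
  have contK: "continuous_on UNIV K"
    unfolding K_def using \<open>c \<noteq> 0\<close> by (intro continuous_intros continuous_on_compose2[OF contg]) auto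
  have Hdeck: "H (deck n m p) = deck (A$1$1 * n + A$1$2 * m) (A$2$1 * n + A$2$2 * m) (H p)" for n m p
  proof -
    obtain x r where p: "p = (x, r)" by (metis surj_pair)
    have "c * (of_int n + of_int m * \<alpha>) = c * of_int n + of_int m * (c * \<alpha>)"
      by (simp add: algebra_simps)
    also have "\<dots> = of_int (A$1$1 * n + A$1$2 * m) + of_int (A$2$1 * n + A$2$2 * m) * \<alpha>"
      unfolding c_def c[symmetric] c\<alpha>[symmetric] by (simp add: algebra_simps)
    finally have 1: "c * (x + of_int n + of_int m * \<alpha>) + \<delta>
        = c * x + \<delta> + of_int (A$1$1 * n + A$1$2 * m) + of_int (A$2$1 * n + A$2$2 * m) * \<alpha>"
      by (simp add: algebra_simps)
    have e: "r - cocycle \<alpha> F m x + g (x + of_int n + of_int m * \<alpha>)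
        = r + g x - s * cocycle \<alpha> F (A$2$1 * n + A$2$2 * m) (c * x + \<delta>)"
      using coh[of n m x] unfolding c_def by linarith
    have 2: "inverse s * (r - cocycle \<alpha> F m x + g (x + of_int n + of_int m * \<alpha>))
        = inverse s * (r + g x) - cocycle \<alpha> F (A$2$1 * n + A$2$2 * m) (c * x + \<delta>)"
      unfolding e using \<open>s \<noteq> 0\<close> by (simp add: right_diff_distrib flip: mult.assoc)
    show ?thesis
      unfolding p H_def deck_def fst_conv snd_conv 1 2 ..
  qed
  \<comment> \<open>The indices come from the inverse matrix \<open>B\<close>: applying
    \<open>Hdeck\<close> to them gives back \<open>n'\<close> and \<open>m'\<close>, and
    \<open>K\<close> undoes \<open>H\<close>.\<close>
  have Kdeck: "\<exists>n m. K (deck n' m' p) = deck n m (K p)" for n' m' p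
  proof -
    define n where "n = B$1$1 * n' + B$1$2 * m'"
    define m where "m = B$2$1 * n' + B$2$2 * m'"
    have e: "A$1$1 * B$1$1 + A$1$2 * B$2$1 = 1" "A$1$1 * B$1$2 + A$1$2 * B$2$2 = 0"
      "A$2$1 * B$1$1 + A$2$2 * B$2$1 = 0" "A$2$1 * B$1$2 + A$2$2 * B$2$2 = 1"
      using AB by (auto simp: vec_eq_iff forall_2 matrix_matrix_mult_def sum_2 mat_def)
    have "A$1$1 * n + A$1$2 * m = (A$1$1 * B$1$1 + A$1$2 * B$2$1) * n' + (A$1$1 * B$1$2 + A$1$2 * B$2$2) * m'"
      by (simp add: n_def m_def algebra_simps)
    moreover have "A$2$1 * n + A$2$2 * m = (A$2$1 * B$1$1 + A$2$2 * B$2$1) * n' + (A$2$1 * B$1$2 + A$2$2 * B$2$2) * m'"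
      by (simp add: n_def m_def algebra_simps)
    ultimately have "H (deck n m (K p)) = deck n' m' p"
      unfolding Hdeck HK e by simp
    then have "K (deck n' m' p) = deck n m (K p)" using KH by metis
    then show ?thesis by blast
  qed
  \<comment> \<open>The conjugacy will be the map induced by \<open>K\<close>, which multiplies
    heights by \<open>s\<close>; \<open>H\<close> induces its inverse.\<close>
  obtain k where contk: "continuous_map X X k" and k: "\<And>p. k (proj p) = proj (H p)"
    by (rule equivariant_map_descends[OF contH]) (auto simp: Hdeck)
  have "proj (K (deck n m p)) = proj (K p)" for n m p
    using Kdeck[of n m p] by auto
  then obtain h where conth: "continuous_map X X h" and h: "\<And>p. h (proj p) = proj (K p)"
    by (rule equivariant_map_descends[OF contK]) auto
  have "homeomorphic_maps X X h k"
    unfolding homeomorphic_maps_def topspace_X by (auto simp: conth contk h k HK KH)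
  then have "homeomorphic_map X X h" unfolding homeomorphic_map_maps by blast
  moreover have "h (special_flow t z) = special_flow (s * t) (h z)" if "z \<in> topspace X" for t z
    using that by (rule topspace_X_cases) (simp add: special_flow_proj h K_def algebra_simps)
  ultimately show ?thesis
    unfolding I_top_def topologically_conjugate_def using \<open>s \<noteq> 0\<close> by blast
qed

text \<open>For \<open>s = -1\<close> irrationality forces \<open>A\<close> to be minus the
  identity. The equation for the generators of the deck group then reduces to periodicity of
  \<open>g\<close> and one cohomological equation on the circle.\<close>

lemma minus_one_in_I_top_iff:
  "- 1 \<in> I_top X special_flow \<longleftrightarrow>
     (\<exists>(g :: circle \<Rightarrow> real) \<delta>. continuous_on UNIV g \<and> (\<forall>x. f (\<delta> - x) - f x = g x - g (rotation \<alpha> x)))"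
proof
  assume "- 1 \<in> I_top X special_flow"
  then obtain A :: "int^2^2" and \<delta> g where "invertible A" and contg: "continuous_on UNIV g"
    and c\<alpha>: "of_int (A$1$2) + of_int (A$2$2) * \<alpha> = (of_int (A$1$1) + of_int (A$2$1) * \<alpha>) * \<alpha>"
    and c: "of_int (A$1$1) + of_int (A$2$1) * \<alpha> = of_int (det A) * (- 1)"
    and s: "- 1 = inverse (of_int (A$2$2) - of_int (A$2$1) * \<alpha>)"
    and coh: "\<And>m n x. - 1 * cocycle \<alpha> F (A$2$1 * n + A$2$2 * m) (of_int (det A) * (- 1) * x + \<delta>) - cocycle \<alpha> F m x
       = g x - g (x + of_int n + of_int m * \<alpha>)"
    by (rule conjugate_imp_cohomologous) (rule that)
  have "of_int (A$2$2) - of_int (A$2$1) * \<alpha> = - 1"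
    using arg_cong[OF s, of inverse] by simp
  then have "of_int (A$2$2) + of_int (- (A$2$1)) * \<alpha> = of_int (- 1) + of_int 0 * \<alpha>" by simp
  then have A2: "A$2$2 = - 1" "A$2$1 = 0"
    unfolding add_of_int_mult_irrational_eq_iff[OF irrational] by auto
  have "of_int (A$1$2) + of_int (- 1) * \<alpha> = of_int 0 + of_int (A$1$1) * \<alpha>"
    using c\<alpha> by (simp add: A2)
  then have "A$1$1 = - 1"
    unfolding add_of_int_mult_irrational_eq_iff[OF irrational] by simp
  then have det: "of_int (det A) * (- 1 :: real) = - 1"
    using c A2 by simp
  have "g (x + 1) = g x" for x
    using coh[of 1 0 x] by (simp add: A2)
  then obtain g' where g': "continuous_on UNIV g'" "\<And>x. g' (to_circle x) = g x"
    using periodic_imp_periodic_lift[OF contg] by blast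
  have "f (to_circle (\<delta> - \<alpha>) - z) - f z = g' z - g' (rotation \<alpha> z)" for z
  proof -
    obtain x where z: "z = to_circle x" by (rule to_circle_cases)
    \<comment> \<open>The cocycle of index -1 samples \<open>F\<close> one rotation earlier, whence
      \<delta> is replaced by \<open>\<delta> - \<alpha>\<close>; the converse compensates with
      \<open>\<delta>0 + \<alpha>\<close>.\<close>
    have "F (\<delta> - \<alpha> - x) - F x = g x - g (x + \<alpha>)"
      using coh[of 0 1 x] cocycle_uminus[of \<alpha> F 1 "\<delta> - x"] unfolding det
      by (simp add: A2 algebra_simps)
    then show ?thesis
      by (simp add: z rotation_def g'(2) periodic_lift_def flip: to_circle_add to_circle_diff)
  qed
  with g'(1) show "\<exists>(g :: circle \<Rightarrow> real) \<delta>. continuous_on UNIV g \<and> (\<forall>x. f (\<delta> - x) - f x = g x - g (rotation \<alpha> x))"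
    by blast
next
  assume "\<exists>(g :: circle \<Rightarrow> real) \<delta>. continuous_on UNIV g \<and> (\<forall>x. f (\<delta> - x) - f x = g x - g (rotation \<alpha> x))"
  then obtain g :: "circle \<Rightarrow> real" and \<delta> where contg: "continuous_on UNIV g"
    and g: "\<And>x. f (\<delta> - x) - f x = g x - g (rotation \<alpha> x)" by blast
  obtain \<delta>0 where \<delta>0: "\<delta> = to_circle \<delta>0" by (rule to_circle_cases)
  define G where "G x = g (to_circle x)" for x
  have contG: "continuous_on UNIV G"
    unfolding G_def by (rule continuous_on_compose2[OF contg continuous_on_to_circle]) simp
  have G_periodic: "G (x + of_int n) = G x" for x n
  proof -
    have "to_circle (x + of_int n) = to_circle x" by (simp add: to_circle_eq_iff)
    then show ?thesis by (simp add: G_def)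
  qed
  have G: "F (\<delta>0 - x) - F x = G x - G (x + \<alpha>)" for x
    using g[of "to_circle x"] by (simp add: \<delta>0 rotation_def G_def periodic_lift_def to_circle_add to_circle_diff)
  define E where "E m x \<longleftrightarrow> - cocycle \<alpha> F (- m) (- x + (\<delta>0 + \<alpha>)) - cocycle \<alpha> F m x = G x - G (x + of_int m * \<alpha>)"
    for m x
  \<comment> \<open>Passing from \<open>m\<close> to \<open>m + 1\<close> changes the two sides by
    those of \<open>G\<close> at \<open>x + m * \<alpha>\<close>. Being an equivalence, it carries
    \<open>E\<close> from 0 in both directions.\<close>
  have step: "E (m + 1) x \<longleftrightarrow> E m x" for m x
  proof -
    have "cocycle \<alpha> F (- m) (- x + (\<delta>0 + \<alpha>))
        = cocycle \<alpha> F (- (m + 1)) (- x + (\<delta>0 + \<alpha>)) + F (\<delta>0 - (x + of_int m * \<alpha>))"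
      using cocycle_Suc[of \<alpha> F "- (m + 1)" "- x + (\<delta>0 + \<alpha>)"] by (simp add: algebra_simps)
    moreover have "cocycle \<alpha> F (m + 1) x = cocycle \<alpha> F m x + F (x + of_int m * \<alpha>)"
      by (rule cocycle_Suc)
    moreover have "G (x + of_int (m + 1) * \<alpha>) = G (x + of_int m * \<alpha> + \<alpha>)"
      by (simp add: algebra_simps)
    ultimately show ?thesis
      using G[of "x + of_int m * \<alpha>"] unfolding E_def by (intro iffI; linarith)
  qed
  have E: "E m x" for m x
  proof (induction m rule: int_induct[where k = 0])
    case (step2 i)
    then show ?case using step[of "i - 1" x] by simp
  qed (simp_all add: step, simp add: E_def)
  define A :: "int^2^2" where "A = vector [vector [- 1, 0], vector [0, - 1]]"
  have A: "A$1$1 = - 1" "A$1$2 = 0" "A$2$1 = 0" "A$2$2 = - 1" by (simp_all add: A_def)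
  have "A ** A = mat 1"
    by (simp add: vec_eq_iff forall_2 matrix_matrix_mult_def sum_2 mat_def A)
  then have inv: "invertible A" unfolding invertible_def by blast
  have det: "det A = 1" by (simp add: det_2 A)
  show "- 1 \<in> I_top X special_flow"
  proof (rule cohomologous_imp_conjugate[OF _ inv contG, where \<delta> = "\<delta>0 + \<alpha>"])
    fix m n x
    show "- 1 * cocycle \<alpha> F (A$2$1 * n + A$2$2 * m) (of_int (det A) * - 1 * x + (\<delta>0 + \<alpha>)) - cocycle \<alpha> F m x
       = G x - G (x + of_int n + of_int m * \<alpha>)"
      using E[of m x] G_periodic[of "x + of_int m * \<alpha>" n] by (simp add: A det E_def add_ac)
  qed (simp_all add: A det)
qed

end

theorem proposition8p5:
  fixes \<alpha> :: real and f :: "circle \<Rightarrow> real"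
  assumes "\<alpha> \<notin> \<rat>"
    and "continuous_on UNIV f"
    and "\<And>x. f x > 0"
  shows
    "(\<forall>s::real. s \<noteq> 0 \<longrightarrow>
        (s \<in> I_top (special_space \<alpha> f) special_flow - {1} \<longleftrightarrow>
          s \<noteq> 1 \<and>
          (\<exists>(A :: int^2^2) (\<delta> :: real) (g :: real \<Rightarrow> real).
             invertible A \<and> continuous_on UNIV g \<and>
             of_int (A$1$2) + of_int (A$2$2) * \<alpha> = (of_int (A$1$1) + of_int (A$2$1) * \<alpha>) * \<alpha> \<and>
             of_int (A$1$1) + of_int (A$2$1) * \<alpha> = of_int (det A) * s \<and>
             of_int (det A) * s = of_int (det A) * inverse (of_int (A$2$2) - of_int (A$2$1) * \<alpha>) \<and>
             (\<forall>(m::int) (n::int) (x::real).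
                s * cocycle \<alpha> (periodic_lift f) (A$2$1 * n + A$2$2 * m) (of_int (det A) * s * x + \<delta>)
                  - cocycle \<alpha> (periodic_lift f) m x
                = g x - g (x + of_int n + of_int m * \<alpha>)))))
     \<and>
     (- 1 \<in> I_top (special_space \<alpha> f) special_flow \<longleftrightarrow>
        (\<exists>(g :: circle \<Rightarrow> real) (\<delta> :: circle).
           continuous_on UNIV g \<and>
           (\<forall>x. f (\<delta> - x) - f x = g x - g (rotation \<alpha> x))))"
proof -
  interpret rotation_special_flow \<alpha> f
    using assms by unfold_locales
  \<comment> \<open>The equivalence holds for every nonzero \<open>s\<close>, including 1; the value
    1 is then excluded on both sides.\<close>
  have "s \<in> I_top X special_flow \<longleftrightarrow>
      (\<exists>(A :: int^2^2) \<delta> g.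
         invertible A \<and> continuous_on UNIV g \<and>
         of_int (A$1$2) + of_int (A$2$2) * \<alpha> = (of_int (A$1$1) + of_int (A$2$1) * \<alpha>) * \<alpha> \<and>
         of_int (A$1$1) + of_int (A$2$1) * \<alpha> = of_int (det A) * s \<and>
         of_int (det A) * s = of_int (det A) * inverse (of_int (A$2$2) - of_int (A$2$1) * \<alpha>) \<and>
         (\<forall>m n x. s * cocycle \<alpha> F (A$2$1 * n + A$2$2 * m) (of_int (det A) * s * x + \<delta>) - cocycle \<alpha> F m x
            = g x - g (x + of_int n + of_int m * \<alpha>)))" (is "_ \<longleftrightarrow> ?R") if "s \<noteq> 0" for s
  proof
    assume "s \<in> I_top X special_flow"
    then show ?R
    proof (rule conjugate_imp_cohomologous)
      fix A :: "int^2^2" and \<delta> g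
      assume "invertible A" "continuous_on UNIV g"
        "of_int (A$1$2) + of_int (A$2$2) * \<alpha> = (of_int (A$1$1) + of_int (A$2$1) * \<alpha>) * \<alpha>"
        "of_int (A$1$1) + of_int (A$2$1) * \<alpha> = of_int (det A) * s"
        and s: "s = inverse (of_int (A$2$2) - of_int (A$2$1) * \<alpha>)"
        and "\<And>m n x. s * cocycle \<alpha> F (A$2$1 * n + A$2$2 * m) (of_int (det A) * s * x + \<delta>) - cocycle \<alpha> F m x
           = g x - g (x + of_int n + of_int m * \<alpha>)"
      then show ?R
        by (intro exI[of _ A] exI[of _ \<delta>] exI[of _ g] conjI allI arg_cong[OF s])
    qed
  next
    assume ?R
    then show "s \<in> I_top X special_flow"
      by (elim exE conjE) (rule cohomologous_imp_conjugate[OF that], auto)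
  qed
  with minus_one_in_I_top_iff show ?thesis by blast
qed

end
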